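(* Let $\mathfrak g$ be a finite-dimensional complex simple Lie algebra of rank $n$ and let $N>2$. As an associative algebra over $\mathbb K=\mathbb C(q)$, the quantum $N$-toroidal algebra $U_q(\mathfrak g_{N,tor})$ is isomorphic to a quotient algebra of $\mathcal U_0(\mathfrak g_{N,tor})$: $$U_q(\mathfrak g_{N,tor})\cong\mathcal U_0(\mathfrak g_{N,tor})/H_2 ,$$ where $H_2$ is the kernel of the algebra epimorphism $\pi_1:\mathcal U_0(\mathfrak g_{N,tor})\to U_q(\mathfrak g_{N,tor})$ that sends each generator of $\mathcal U_0(\mathfrak g_{N,tor})$ to the generator of $U_q(\mathfrak g_{N,tor})$ denoted by the same symbol (the existence of such an epimorphism being part of the assertion).
   Context: Notation. $\mathfrak g$ is a complex simple Lie algebra of rank $n$; $I=\{0,1,\dots,n\}$; $(a_{ij})_{i,j\in I}$ is the generalized Cartan matrix of the untwisted affine Lie algebra $\hat{\mathfrak g}$ ($0$ is the affine node); $d_i$ are positive integers with $(d_ia_{ij})$ symmetric. $\mathbb K=\mathbb C(q)$, $q_i=q^{d_i}$, $[m]_i=\frac{q_i^m-q_i^{-m}}{q_i-q_i^{-1}}$, $\Big[{m\atop k}\Big]_i$ the corresponding $q_i$-binomial. $[a,b]_v=ab-v\,ba$, $[a,b]=[a,b]_1$. $J=\{1,\dots,N-1\}$; $e_s$ ($s\in J$) is the $s$-th standard unit vector of $\mathbb Z^{N-1}$, $\underline0$ the zero vector. $\mathrm{Sym}_{m_1,\dots,m_r}$ is the sum over all permutations of $(m_1,\dots,m_r)$.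 The symbol $\epsilon$ stands for $\pm1$ or the corresponding sign. Quantum $N$-toroidal algebra. $U_q(\mathfrak g_{N,tor})$ is the associative $\mathbb K$-algebra generated by $x_i^{\pm}(\underline k)$, $a_i^{(s)}(\ell)$, $K_i^{\pm1}$, $\gamma_s^{\pm1/2}$, $q^{\pm d}$ ($i\in I$, $s\in J$, $\underline k\in\mathbb Z^{N-1}$, $\ell\in\mathbb Z\setminus\{0\}$) with relations: (T1) $\gamma_s^{\pm1/2}$ are central, $\gamma_s^{1/2}\gamma_s^{-1/2}=1$, $K_i^{\pm1}K_i^{\mp1}=1=q^{\pm d}q^{\mp d}$, and the $K_i^{\pm1}$ commute with each other; (T2) $[a_i^{(s)}(\ell),K_j^{\pm1}]=0=[K_j^{\pm1},q^{\pm d}]=[a_i^{(s)}(\ell),q^{\pm d}]$; (T3) $[a_i^{(s)}(\ell),a_j^{(s')}(\ell')]=\delta_{\ell+\ell',0}\frac{[\ell a_{ij}]_i}{\ell}\cdot\frac{(\gamma_s\gamma_{s'})^{\ell/2}-(\gamma_s\gamma_{s'})^{-\ell/2}}{q_j-q_j^{-1}}$; (T4) $q^dx_i^\pm(\underline k)q^{-d}=q^{\pm\delta_{i,0}}x_i^\pm(\underline k)$, $K_ix_j^\pm(\underline k)K_i^{-1}=q_i^{\pm a_{ij}}x_j^\pm(\underline k)$; (T5) $[a_i^{(s)}(\ell),x_j^\pm(\underline k)]=\pm\frac{[\ell a_{ij}]_i}{\ell}\gamma_s^{\mp|\ell|/2}x_j^\pm(\underline k+\ell e_s)$; (T6) $[x_i^\pm(ke_s),x_i^\pm(ke_{s'})]=0$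 ($k\in\mathbb Z$); (T7) $[x_i^\pm((t+1)e_s),x_j^\pm(t'e_s)]_{q_i^{\pm a_{ij}}}+[x_j^\pm((t'+1)e_s),x_i^\pm(te_s)]_{q_i^{\pm a_{ij}}}=0$ ($t,t'\in\mathbb Z$); (T8) $[x_i^+(te_s),x_j^-(t'e_s)]=\frac{\delta_{ij}}{q_i-q_i^{-1}}\big(\gamma_s^{\frac{t-t'}2}\phi_i^{(s)}(t+t')-\gamma_s^{\frac{t'-t}2}\varphi_i^{(s)}(t+t')\big)$, where $\sum_{m\ge0}\phi_i^{(s)}(m)z^{-m}=K_i\exp\big((q_i-q_i^{-1})\sum_{\ell\ge1}a_i^{(s)}(\ell)z^{-\ell}\big)$, $\sum_{m\ge0}\varphi_i^{(s)}(-m)z^m=K_i^{-1}\exp\big(-(q_i-q_i^{-1})\sum_{\ell\ge1}a_i^{(s)}(-\ell)z^\ell\big)$, and $\phi_i^{(s)}(m)=0=\varphi_i^{(s)}(-m)$ for $m<0$; (T9) for $i\ne j$, $s\in J$, $r=1-a_{ij}$: $\mathrm{Sym}_{m_1,\dots,m_r}\sum_{k=0}^{r}(-1)^k\Big[{r\atop k}\Big]_ix_i^\pm(m_1e_s)\cdots x_i^\pm(m_ke_s)x_j^\pm(\ell e_s)x_i^\pm(m_{k+1}e_s)\cdots x_i^\pm(m_re_s)=0$; (T10) for $i\in I$, $s\ne s'\in J$, $m_1m_2m_3\ell\ne0$: $\sum_{k=0}^3(-1)^k\Big[{3\atop k}\Big]_ix_i^\pm(m_1e_s)\cdots x_i^\pm(m_{3-k}e_s)x_i^\mp(\ell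 e_{s'})x_i^\pm(m_{4-k}e_s)\cdots x_i^\pm(m_3e_s)=0$. The algebra $\mathcal U_0(\mathfrak g_{N,tor})$. It is the associative $\mathbb K$-algebra generated by $x_i^\pm(\underline0)$, $x_0^{-\epsilon}(\epsilon e_s)$, $K_i^{\pm1}$, $q^{\pm d}$, $\gamma_s^{\pm1/2}$ ($\epsilon=\pm$, $i\in I$, $s\in J$) with relations: (1) $\gamma_s^{\pm1/2}$ central, $\gamma_s^{1/2}\gamma_s^{-1/2}=1$; $q^{\pm d},K_i^{\pm1}$ commute with each other, $K_i^{\pm1}K_i^{\mp1}=1=q^{\pm d}q^{\mp d}$; (2) $K_ix_j^\pm(\underline0)K_i^{-1}=q_i^{\pm a_{ij}}x_j^\pm(\underline0)$, $K_ix_0^{-\epsilon}(\epsilon e_s)K_i^{-1}=q_i^{-\epsilon a_{i0}}x_0^{-\epsilon}(\epsilon e_s)$; (3) $[x_i^\epsilon(\underline0),x_0^{-\epsilon}(\epsilon e_s)]=0$ for $i\ne0$; (4) $[x_i^+(\underline0),x_j^-(\underline0)]=\delta_{ij}\frac{K_i-K_i^{-1}}{q_i-q_i^{-1}}$, $[x_0^+(-e_s),x_0^-(e_s)]=\frac{\gamma_s^{-1}K_0-\gamma_sK_0^{-1}}{q_0-q_0^{-1}}$; (5) $q^dx_i^\pm(\underline0)q^{-d}=q^{\pm\delta_{0,i}}x_i^\pm(\underline0)$, $q^dx_0^{-\epsilon}(\epsilon e_s)q^{-d}=q^{-\epsilon}x_0^{-\epsilon}(\epsilon e_s)$; (6)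 $[x_0^{-\epsilon}(\epsilon e_s),x_0^{-\epsilon}(\underline0)]_{q_0^{-2}}=0$, and $[x_0^{-\epsilon}(\epsilon e_s),x_0^{-\epsilon}(\epsilon e_{s'})]=0$ for $s\ne s'$; (7) for $i\ne j$, $r=1-a_{ij}$: $\sum_{t=0}^{r}(-1)^t\Big[{r\atop t}\Big]_ix_i^\pm(\underline0)^{r-t}x_j^\pm(\underline0)x_i^\pm(\underline0)^t=0$; (8) for $j\ne0$, $r=1-a_{j0}$: $\sum_{t=0}^r(-1)^t\Big[{r\atop t}\Big]_jx_j^\epsilon(\underline0)^{r-t}x_0^\epsilon(-\epsilon e_s)x_j^\epsilon(\underline0)^t=0$; (9) for $j\ne0$, $r=1-a_{0j}$: $\sum_{t=0}^r(-1)^t\Big[{r\atop t}\Big]_0x_0^\epsilon(-\epsilon e_s)^{r-t}x_j^\epsilon(\underline0)x_0^\epsilon(-\epsilon e_s)^t=0$; (10) for $j\ne0$, $r=1-a_{0j}$ and all $m_1,\dots,m_r\in\{\underline0,-\epsilon e_s\}$: $\mathrm{Sym}_{m_1,\dots,m_r}\sum_{t=0}^r(-1)^t\Big[{r\atop t}\Big]_0x_0^\epsilon(m_1)\cdots x_0^\epsilon(m_{r-t})x_j^\epsilon(\underline0)x_0^\epsilon(m_{r-t+1})\cdots x_0^\epsilon(m_r)=0$; (11) $\sum_{t=0}^3(-1)^tq_0^{-2t}\Big[{3\atop t}\Big]_0x_0^\epsilon(\underline0)^{3-t}x_0^{-\epsilon}(\epsilon e_s)x_0^\epsilon(\underline0)^t=0$;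 (12) $\sum_{t=0}^3(-1)^tq_0^{2t}\Big[{3\atop t}\Big]_0x_0^\epsilon(-\epsilon e_s)^{3-t}x_0^{-\epsilon}(\underline0)x_0^\epsilon(-\epsilon e_s)^t=0$; (13) for $s\ne s'$: $\sum_{t=0}^3(-1)^t\Big[{3\atop t}\Big]_0x_0^\epsilon(-\epsilon e_s)^{3-t}x_0^{-\epsilon}(\epsilon e_{s'})x_0^\epsilon(-\epsilon e_s)^t=0$. *)

theory Defs
  imports
    Complex_Main
    "HOL-Library.Poly_Mapping"
    "HOL-Combinatorics.Permutations"
    "HOL-Computational_Algebra.Polynomial"
    "HOL-Computational_Algebra.Fraction_Field"
    "HOL-Computational_Algebra.Formal_Power_Series"
    "HOL-Algebra.Module"
    "HOL-Algebra.QuotRing"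
begin

section \<open>Complex simple Lie algebras and their affine Cartan matrices\<close>

locale complex_lie_algebra = vector_space scale
  for scale :: "complex \<Rightarrow> 'g::ab_group_add \<Rightarrow> 'g" +
  fixes lie :: "'g \<Rightarrow> 'g \<Rightarrow> 'g"
  assumes lie_add_left: "lie (x + y) z = lie x z + lie y z"
    and lie_add_right: "lie x (y + z) = lie x y + lie x z"
    and lie_scale_left: "lie (scale c x) y = scale c (lie x y)"
    and lie_scale_right: "lie x (scale c y) = scale c (lie x y)"
    and lie_self: "lie x x = 0"
    and jacobi: "lie x (lie y z) + lie y (lie z x) + lie z (lie x y) = 0"
begin

definition lie_subalgebra :: "'g set \<Rightarrow> bool" where
  "lie_subalgebra H \<longleftrightarrow> subspace H \<and> (\<forall>x\<in>H. \<forall>y\<in>H. lie x y \<in> H)"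

definition lie_ideal :: "'g set \<Rightarrow> bool" where
  "lie_ideal H \<longleftrightarrow> subspace H \<and> (\<forall>x. \<forall>y\<in>H. lie x y \<in> H)"

definition lie_generates :: "'g set \<Rightarrow> bool" where
  "lie_generates S \<longleftrightarrow> (\<forall>H. lie_subalgebra H \<and> S \<subseteq> H \<longrightarrow> H = UNIV)"

primrec lower_central :: "'g set \<Rightarrow> nat \<Rightarrow> 'g set" where
  "lower_central H 0 = H"
| "lower_central H (Suc k) = span {lie x y | x y. x \<in> H \<and> y \<in> lower_central H k}"

definition cartan_subalgebra :: "'g set \<Rightarrow> bool" where
  "cartan_subalgebra H \<longleftrightarrow> lie_subalgebra H \<and> (\<exists>k. lower_central H k = {0})
     \<and> {x. \<forall>h\<in>H. lie x h \<in> H} = H"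

text \<open>Elements of the dual space of \<open>H\<close> are represented by functions on the whole Lie algebra,
  of which only the values on \<open>H\<close> matter.\<close>

definition root_space :: "'g set \<Rightarrow> ('g \<Rightarrow> complex) \<Rightarrow> 'g set" where
  "root_space H \<alpha> = {x. \<forall>h\<in>H. lie h x = scale (\<alpha> h) x}"

definition is_root :: "'g set \<Rightarrow> ('g \<Rightarrow> complex) \<Rightarrow> bool" where
  "is_root H \<alpha> \<longleftrightarrow> (\<forall>x\<in>H. \<forall>y\<in>H. \<alpha> (x + y) = \<alpha> x + \<alpha> y)
     \<and> (\<forall>c. \<forall>x\<in>H. \<alpha> (scale c x) = c * \<alpha> x)
     \<and> (\<exists>h\<in>H. \<alpha> h \<noteq> 0) \<and> root_space H \<alpha> \<noteq> {0}"

definition simple_roots :: "'g set \<Rightarrow> nat \<Rightarrow> (nat \<Rightarrow> 'g \<Rightarrow> complex) \<Rightarrow> bool" where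
  "simple_roots H n \<alpha> \<longleftrightarrow> (\<forall>i\<in>{1..n}. is_root H (\<alpha> i))
     \<and> (\<forall>c :: nat \<Rightarrow> complex. (\<forall>h\<in>H. (\<Sum>i=1..n. c i * \<alpha> i h) = 0) \<longrightarrow> (\<forall>i\<in>{1..n}. c i = 0))
     \<and> (\<forall>\<beta>. is_root H \<beta> \<longrightarrow> (\<exists>c :: nat \<Rightarrow> int.
            ((\<forall>i\<in>{1..n}. 0 \<le> c i) \<or> (\<forall>i\<in>{1..n}. c i \<le> 0))
          \<and> (\<forall>h\<in>H. \<beta> h = (\<Sum>i=1..n. of_int (c i) * \<alpha> i h))))"

definition highest_root ::
    "'g set \<Rightarrow> nat \<Rightarrow> (nat \<Rightarrow> 'g \<Rightarrow> complex) \<Rightarrow> ('g \<Rightarrow> complex) \<Rightarrow> bool" where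
  "highest_root H n \<alpha> \<theta> \<longleftrightarrow> is_root H \<theta>
     \<and> (\<forall>\<beta>. is_root H \<beta> \<longrightarrow> (\<exists>c :: nat \<Rightarrow> nat.
            \<forall>h\<in>H. \<theta> h - \<beta> h = (\<Sum>i=1..n. of_nat (c i) * \<alpha> i h)))"

text \<open>The generalized Cartan matrix of the untwisted affine Lie algebra of a simple Lie algebra of
  rank \<open>n\<close>: with simple roots \<open>\<alpha>\<^sub>1, \<dots>, \<alpha>\<^sub>n\<close>, highest root \<open>\<theta>\<close> and \<open>\<alpha>\<^sub>0 = -\<theta>\<close>, its entries
  are \<open>a\<^sub>i\<^sub>j = \<alpha>\<^sub>j(h\<^sub>i)\<close>, where \<open>h\<^sub>i = [e\<^sub>i, f\<^sub>i]\<close> is the coroot of \<open>\<alpha>\<^sub>i\<close>, read off from an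
  \<open>sl\<^sub>2\<close>-triple with \<open>e\<^sub>i\<close> in the root space of \<open>\<alpha>\<^sub>i\<close> and \<open>f\<^sub>i\<close> in that of \<open>-\<alpha>\<^sub>i\<close>. The elements
  \<open>e\<^sub>i, f\<^sub>i\<close> with \<open>1 \<le> i \<le> n\<close> are Chevalley generators of the finite-dimensional algebra. Those
  for \<open>i = 0\<close> give the affine ones as \<open>t \<otimes> e\<^sub>0\<close> and \<open>t\<^sup>-\<^sup>1 \<otimes> f\<^sub>0\<close>; modulo the central
  element the coroot of the affine node is \<open>[e\<^sub>0, f\<^sub>0]\<close>.\<close>

definition affine_cartan_matrix :: "nat \<Rightarrow> (nat \<Rightarrow> nat \<Rightarrow> int) \<Rightarrow> bool" where
  "affine_cartan_matrix n a \<longleftrightarrow> (\<exists>H \<alpha> e f.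
       cartan_subalgebra H \<and> dim H = n
     \<and> simple_roots H n \<alpha> \<and> highest_root H n \<alpha> (\<lambda>h. - \<alpha> 0 h)
     \<and> (\<forall>i\<in>{0..n}. e i \<in> root_space H (\<alpha> i) \<and> f i \<in> root_space H (\<lambda>h. - \<alpha> i h)
          \<and> \<alpha> i (lie (e i) (f i)) = 2)
     \<and> lie_generates (e ` {1..n} \<union> f ` {1..n})
     \<and> (\<forall>i\<in>{0..n}. \<forall>j\<in>{0..n}. of_int (a i j) = \<alpha> j (lie (e i) (f i))))"

end

locale simple_lie_algebra = complex_lie_algebra +
  assumes finite_dimensional: "\<exists>B. finite B \<and> span B = UNIV"
    and non_abelian: "\<exists>x y. lie x y \<noteq> 0"
    and no_proper_ideal: "lie_ideal L \<Longrightarrow> L = {0} \<or> L = UNIV"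


section \<open>Associative algebras given by generators and relations\<close>

type_synonym Cq = "complex poly fract"

definition q :: Cq where "q = Fract [:0, 1:] 1"

text \<open>The free monoid, so that \<open>'x free_word \<Rightarrow>\<^sub>0 Cq\<close> is the free associative algebra on \<open>'x\<close>
  with convolution product.\<close>

datatype 'x free_word = Free_Word (letters: "'x list")

instantiation free_word :: (type) monoid_add
begin
definition zero_free_word :: "'a free_word" where "0 = Free_Word []"
definition plus_free_word :: "'a free_word \<Rightarrow> 'a free_word \<Rightarrow> 'a free_word" where
  "u + v = Free_Word (letters u @ letters v)"
instance
  by standard (simp_all add: zero_free_word_def plus_free_word_def)
end

type_synonym 'x free_alg = "'x free_word \<Rightarrow>\<^sub>0 Cq"

definition scal :: "Cq \<Rightarrow> 'x free_alg \<Rightarrow> 'x free_alg" (infixr "*\<^sub>K" 75) where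
  "c *\<^sub>K f = Poly_Mapping.single 0 c * f"

definition gen :: "'x \<Rightarrow> 'x free_alg" where
  "gen g = Poly_Mapping.single (Free_Word [g]) 1"

text \<open>Records of type \<open>(Cq, _) module\<close> serve as associative unital \<open>Cq\<close>-algebras; the locale
  \<open>algebra\<close> of HOL-Algebra is not used because it requires commutativity.\<close>

definition free_algebra :: "'x set \<Rightarrow> (Cq, 'x free_alg) module" where
  "free_algebra G =
     \<lparr>carrier = {f. \<forall>w\<in>Poly_Mapping.keys f. set (letters w) \<subseteq> G},
      mult = (*), one = 1, zero = 0, add = (+), smult = (*\<^sub>K)\<rparr>"

definition alg_quot :: "('k, 'a) module \<Rightarrow> 'a set \<Rightarrow> ('k, 'a set) module" where
  "alg_quot A L =
     \<lparr>carrier = carrier (A Quot L), mult = mult (A Quot L), one = one (A Quot L),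
      zero = zero (A Quot L), add = add (A Quot L),
      smult = (\<lambda>c X. \<Union>x\<in>X. L +>\<^bsub>A\<^esub> (c \<odot>\<^bsub>A\<^esub> x))\<rparr>"

definition alg_hom :: "('k, 'a) module \<Rightarrow> ('k, 'b) module \<Rightarrow> ('a \<Rightarrow> 'b) set" where
  "alg_hom A B = {h \<in> ring_hom A B. \<forall>c. \<forall>x\<in>carrier A. h (c \<odot>\<^bsub>A\<^esub> x) = c \<odot>\<^bsub>B\<^esub> h x}"

definition alg_epi :: "('k, 'a) module \<Rightarrow> ('k, 'b) module \<Rightarrow> ('a \<Rightarrow> 'b) set" where
  "alg_epi A B = {h \<in> alg_hom A B. h ` carrier A = carrier B}"

definition alg_isomorphic :: "('k, 'a) module \<Rightarrow> ('k, 'b) module \<Rightarrow> bool" where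
  "alg_isomorphic A B \<longleftrightarrow> (\<exists>h\<in>alg_hom A B. bij_betw h (carrier A) (carrier B))"

text \<open>A relation \<open>l = r\<close> is represented by the element \<open>l - r\<close> of the free algebra.\<close>

definition presented :: "'x set \<Rightarrow> 'x free_alg set \<Rightarrow> (Cq, 'x free_alg set) module" where
  "presented G R = alg_quot (free_algebra G) (genideal (free_algebra G) R)"

definition pres_class :: "'x set \<Rightarrow> 'x free_alg set \<Rightarrow> 'x free_alg \<Rightarrow> 'x free_alg set" where
  "pres_class G R f = genideal (free_algebra G) R +>\<^bsub>free_algebra G\<^esub> f"


section \<open>Quantum integers, commutators and exponentials\<close>

definition qint :: "Cq \<Rightarrow> int \<Rightarrow> Cq" where
  "qint v m = (v powi m - v powi (- m)) / (v - inverse v)"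

definition qfact :: "Cq \<Rightarrow> nat \<Rightarrow> Cq" where
  "qfact v m = (\<Prod>k=1..m. qint v (int k))"

definition qbinom :: "Cq \<Rightarrow> nat \<Rightarrow> nat \<Rightarrow> Cq" where
  "qbinom v m k = qfact v m / (qfact v k * qfact v (m - k))"

definition qcomm :: "Cq \<Rightarrow> 'x free_alg \<Rightarrow> 'x free_alg \<Rightarrow> 'x free_alg" where
  "qcomm v f g = f * g - v *\<^sub>K (g * f)"

abbreviation comm :: "'x free_alg \<Rightarrow> 'x free_alg \<Rightarrow> 'x free_alg" where
  "comm f g \<equiv> qcomm 1 f g"

text \<open>The exponential of a power series without constant term; the coefficient of degree \<open>m\<close> in
  \<open>Y\<^sup>k\<close> then vanishes for \<open>k > m\<close>, so the exponential series is a finite sum in each degree.\<close>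

definition exp_series :: "'x free_alg fps \<Rightarrow> 'x free_alg fps" where
  "exp_series Y = Abs_fps (\<lambda>m. \<Sum>k\<le>m. (1 / of_nat (fact k)) *\<^sub>K fps_nth (Y ^ k) m)"

text \<open>The product \<open>x\<^sub>1 \<cdots> x\<^sub>p y x\<^sub>p\<^sub>+\<^sub>1 \<cdots> x\<^sub>r\<close>.\<close>

definition insert_prod ::
    "nat \<Rightarrow> (nat \<Rightarrow> 'x free_alg) \<Rightarrow> 'x free_alg \<Rightarrow> nat \<Rightarrow> 'x free_alg" where
  "insert_prod r x y p =
     (\<Prod>u\<leftarrow>[1..<p+1]. x u) * y * (\<Prod>u\<leftarrow>[p+1..<r+1]. x u)"


section \<open>The two algebras\<close>

datatype sign = Positive | Negative

primrec sg :: "sign \<Rightarrow> int" where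
  "sg Positive = 1"
| "sg Negative = -1"

primrec opp :: "sign \<Rightarrow> sign" where
  "opp Positive = Negative"
| "opp Negative = Positive"

text \<open>\<open>GX \<epsilon> i k\<close> is \<open>x\<^sub>i\<^sup>\<epsilon>(k)\<close>, \<open>GA s i l\<close> is \<open>a\<^sub>i\<^sup>(\<^sup>s\<^sup>)(l)\<close>, \<open>GK \<epsilon> i\<close> is \<open>K\<^sub>i\<^sup>\<epsilon>\<close>, \<open>GC \<epsilon> s\<close> is
  \<open>\<gamma>\<^sub>s\<close> to the power \<open>\<epsilon>/2\<close>, and \<open>GD \<epsilon>\<close> is \<open>q\<close> to the power \<open>\<epsilon>d\<close>. The generators of the second
  algebra are a subset of those of the first, so that equally named generators are equal.\<close>

datatype tor_gen =
    GX sign nat "nat \<Rightarrow> int"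
  | GA nat nat int
  | GK sign nat
  | GC sign nat
  | GD sign

type_synonym tor_free = "tor_gen free_alg"

abbreviation "x\<^sub>g \<epsilon> i k \<equiv> gen (GX \<epsilon> i k)"
abbreviation "a\<^sub>g s i l \<equiv> gen (GA s i l)"
abbreviation "K\<^sub>g \<epsilon> i \<equiv> gen (GK \<epsilon> i)"
abbreviation "c\<^sub>g \<epsilon> s \<equiv> gen (GC \<epsilon> s)"
abbreviation "d\<^sub>g \<epsilon> \<equiv> gen (GD \<epsilon>)"

text \<open>\<open>ax k s\<close> is \<open>k e\<^sub>s\<close>; in particular \<open>ax 0 s\<close> is the zero vector.\<close>

definition ax :: "int \<Rightarrow> nat \<Rightarrow> nat \<Rightarrow> int" where
  "ax k s = (\<lambda>r. if r = s then k else 0)"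

definition zero_vec :: "nat \<Rightarrow> int" where
  "zero_vec = (\<lambda>r. 0)"

text \<open>\<open>\<gamma>\<^sub>s\<close> to the power \<open>m/2\<close>.\<close>

definition gam_half :: "nat \<Rightarrow> int \<Rightarrow> tor_free" where
  "gam_half s m = (if 0 \<le> m then c\<^sub>g Positive s ^ nat m else c\<^sub>g Negative s ^ nat (- m))"

text \<open>The locale has no assumptions: it only fixes the rank \<open>n\<close>, the number \<open>N\<close>, the matrix \<open>a\<close>
  and the symmetrizing integers \<open>d\<close>.\<close>

locale toroidal_data =
  fixes n N :: nat
    and a :: "nat \<Rightarrow> nat \<Rightarrow> int"
    and d :: "nat \<Rightarrow> nat"
begin

definition I :: "nat set" where "I = {0..n}"

definition J :: "nat set" where "J = {1..N - 1}"

definition Lat :: "(nat \<Rightarrow> int) set" where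
  "Lat = {k. \<forall>s. s \<notin> J \<longrightarrow> k s = 0}"

definition qq :: "nat \<Rightarrow> Cq" where "qq i = q ^ d i"

text \<open>The coefficient \<open>[l a\<^sub>i\<^sub>j]\<^sub>i / l\<close>.\<close>

definition acoef :: "nat \<Rightarrow> nat \<Rightarrow> int \<Rightarrow> Cq" where
  "acoef i j l = qint (qq i) (l * a i j) / of_int l"

definition phi :: "nat \<Rightarrow> nat \<Rightarrow> int \<Rightarrow> tor_free" where
  "phi s i m = (if m < 0 then 0 else
     K\<^sub>g Positive i * fps_nth (exp_series (Abs_fps (\<lambda>l.
        if l = 0 then 0 else (qq i - inverse (qq i)) *\<^sub>K a\<^sub>g s i (int l)))) (nat m))"

definition varphi :: "nat \<Rightarrow> nat \<Rightarrow> int \<Rightarrow> tor_free" where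
  "varphi s i m = (if m > 0 then 0 else
     K\<^sub>g Negative i * fps_nth (exp_series (Abs_fps (\<lambda>l.
        if l = 0 then 0 else (- (qq i - inverse (qq i))) *\<^sub>K a\<^sub>g s i (- int l)))) (nat (- m)))"

definition tor_gens :: "tor_gen set" where
  "tor_gens =
     {GX \<epsilon> i k | \<epsilon> i k. i \<in> I \<and> k \<in> Lat}
   \<union> {GA s i l | s i l. s \<in> J \<and> i \<in> I \<and> l \<noteq> 0}
   \<union> {GK \<epsilon> i | \<epsilon> i. i \<in> I} \<union> {GC \<epsilon> s | \<epsilon> s. s \<in> J} \<union> range GD"

inductive_set tor_rels :: "tor_free set" where
  T1_central: "\<lbrakk>s \<in> J; g \<in> tor_gens\<rbrakk> \<Longrightarrow> comm (c\<^sub>g \<epsilon> s) (gen g) \<in> tor_rels"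
| T1_gamma: "s \<in> J \<Longrightarrow> c\<^sub>g Positive s * c\<^sub>g Negative s - 1 \<in> tor_rels"
| T1_K_inv: "i \<in> I \<Longrightarrow> K\<^sub>g \<epsilon> i * K\<^sub>g (opp \<epsilon>) i - 1 \<in> tor_rels"
| T1_d_inv: "d\<^sub>g \<epsilon> * d\<^sub>g (opp \<epsilon>) - 1 \<in> tor_rels"
| T1_K_comm: "\<lbrakk>i \<in> I; j \<in> I\<rbrakk> \<Longrightarrow> comm (K\<^sub>g \<epsilon> i) (K\<^sub>g \<epsilon>' j) \<in> tor_rels"
| T2_a_K: "\<lbrakk>s \<in> J; i \<in> I; j \<in> I; l \<noteq> 0\<rbrakk> \<Longrightarrow> comm (a\<^sub>g s i l) (K\<^sub>g \<epsilon> j) \<in> tor_rels"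
| T2_K_d: "j \<in> I \<Longrightarrow> comm (K\<^sub>g \<epsilon> j) (d\<^sub>g \<epsilon>') \<in> tor_rels"
| T2_a_d: "\<lbrakk>s \<in> J; i \<in> I; l \<noteq> 0\<rbrakk> \<Longrightarrow> comm (a\<^sub>g s i l) (d\<^sub>g \<epsilon>) \<in> tor_rels"
| T3: "\<lbrakk>s \<in> J; s' \<in> J; i \<in> I; j \<in> I; l \<noteq> 0; l' \<noteq> 0\<rbrakk> \<Longrightarrow>
    comm (a\<^sub>g s i l) (a\<^sub>g s' j l')
      - (if l + l' = 0
         then (acoef i j l / (qq j - inverse (qq j))) *\<^sub>K
                (gam_half s l * gam_half s' l - gam_half s (- l) * gam_half s' (- l))
         else 0) \<in> tor_rels"
| T4_d: "\<lbrakk>i \<in> I; k \<in> Lat\<rbrakk> \<Longrightarrow>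
    d\<^sub>g Positive * x\<^sub>g \<epsilon> i k * d\<^sub>g Negative
      - (q powi (sg \<epsilon> * (if i = 0 then 1 else 0))) *\<^sub>K x\<^sub>g \<epsilon> i k \<in> tor_rels"
| T4_K: "\<lbrakk>i \<in> I; j \<in> I; k \<in> Lat\<rbrakk> \<Longrightarrow>
    K\<^sub>g Positive i * x\<^sub>g \<epsilon> j k * K\<^sub>g Negative i
      - (qq i powi (sg \<epsilon> * a i j)) *\<^sub>K x\<^sub>g \<epsilon> j k \<in> tor_rels"
| T5: "\<lbrakk>s \<in> J; i \<in> I; j \<in> I; l \<noteq> 0; k \<in> Lat\<rbrakk> \<Longrightarrow>
    comm (a\<^sub>g s i l) (x\<^sub>g \<epsilon> j k)
      - (of_int (sg \<epsilon>) * acoef i j l) *\<^sub>K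
          (gam_half s (- sg \<epsilon> * \<bar>l\<bar>) * x\<^sub>g \<epsilon> j (\<lambda>r. k r + ax l s r)) \<in> tor_rels"
| T6: "\<lbrakk>s \<in> J; s' \<in> J; i \<in> I\<rbrakk> \<Longrightarrow>
    comm (x\<^sub>g \<epsilon> i (ax k s)) (x\<^sub>g \<epsilon> i (ax k s')) \<in> tor_rels"
| T7: "\<lbrakk>s \<in> J; i \<in> I; j \<in> I\<rbrakk> \<Longrightarrow>
    qcomm (qq i powi (sg \<epsilon> * a i j)) (x\<^sub>g \<epsilon> i (ax (t + 1) s)) (x\<^sub>g \<epsilon> j (ax t' s))
    + qcomm (qq i powi (sg \<epsilon> * a i j)) (x\<^sub>g \<epsilon> j (ax (t' + 1) s)) (x\<^sub>g \<epsilon> i (ax t s)) \<in> tor_rels"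
| T8: "\<lbrakk>s \<in> J; i \<in> I; j \<in> I\<rbrakk> \<Longrightarrow>
    comm (x\<^sub>g Positive i (ax t s)) (x\<^sub>g Negative j (ax t' s))
      - (if i = j
         then (1 / (qq i - inverse (qq i))) *\<^sub>K
                (gam_half s (t - t') * phi s i (t + t') - gam_half s (t' - t) * varphi s i (t + t'))
         else 0) \<in> tor_rels"
| T9: "\<lbrakk>s \<in> J; i \<in> I; j \<in> I; i \<noteq> j; r = nat (1 - a i j)\<rbrakk> \<Longrightarrow>
    (\<Sum>\<sigma> | \<sigma> permutes {1..r}. \<Sum>k\<le>r. ((-1) ^ k * qbinom (qq i) r k) *\<^sub>K
       insert_prod r (\<lambda>p. x\<^sub>g \<epsilon> i (ax (m (\<sigma> p)) s)) (x\<^sub>g \<epsilon> j (ax l s)) k) \<in> tor_rels"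
| T10: "\<lbrakk>s \<in> J; s' \<in> J; s \<noteq> s'; i \<in> I; m 1 * m 2 * m 3 * l \<noteq> 0\<rbrakk> \<Longrightarrow>
    (\<Sum>k\<le>3. ((-1) ^ k * qbinom (qq i) 3 k) *\<^sub>K
       insert_prod 3 (\<lambda>p. x\<^sub>g \<epsilon> i (ax (m (p :: nat)) s)) (x\<^sub>g (opp \<epsilon>) i (ax l s')) (3 - k))
       \<in> tor_rels"

definition U_tor :: "(Cq, tor_free set) module" where
  "U_tor = presented tor_gens tor_rels"

definition gens0 :: "tor_gen set" where
  "gens0 =
     {GX \<epsilon> i zero_vec | \<epsilon> i. i \<in> I}
   \<union> {GX (opp \<epsilon>) 0 (ax (sg \<epsilon>) s) | \<epsilon> s. s \<in> J}
   \<union> {GK \<epsilon> i | \<epsilon> i. i \<in> I} \<union> range GD \<union> {GC \<epsilon> s | \<epsilon> s. s \<in> J}"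

inductive_set rels0 :: "tor_free set" where
  R1_central: "\<lbrakk>s \<in> J; g \<in> gens0\<rbrakk> \<Longrightarrow> comm (c\<^sub>g \<epsilon> s) (gen g) \<in> rels0"
| R1_gamma: "s \<in> J \<Longrightarrow> c\<^sub>g Positive s * c\<^sub>g Negative s - 1 \<in> rels0"
| R1_K_comm: "\<lbrakk>i \<in> I; j \<in> I\<rbrakk> \<Longrightarrow> comm (K\<^sub>g \<epsilon> i) (K\<^sub>g \<epsilon>' j) \<in> rels0"
| R1_d_K: "i \<in> I \<Longrightarrow> comm (d\<^sub>g \<epsilon>) (K\<^sub>g \<epsilon>' i) \<in> rels0"
| R1_K_inv: "i \<in> I \<Longrightarrow> K\<^sub>g \<epsilon> i * K\<^sub>g (opp \<epsilon>) i - 1 \<in> rels0"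
| R1_d_inv: "d\<^sub>g \<epsilon> * d\<^sub>g (opp \<epsilon>) - 1 \<in> rels0"
| R2: "\<lbrakk>i \<in> I; j \<in> I\<rbrakk> \<Longrightarrow>
    K\<^sub>g Positive i * x\<^sub>g \<epsilon> j zero_vec * K\<^sub>g Negative i
      - (qq i powi (sg \<epsilon> * a i j)) *\<^sub>K x\<^sub>g \<epsilon> j zero_vec \<in> rels0"
| R2_0: "\<lbrakk>i \<in> I; s \<in> J\<rbrakk> \<Longrightarrow>
    K\<^sub>g Positive i * x\<^sub>g (opp \<epsilon>) 0 (ax (sg \<epsilon>) s) * K\<^sub>g Negative i
      - (qq i powi (- sg \<epsilon> * a i 0)) *\<^sub>K x\<^sub>g (opp \<epsilon>) 0 (ax (sg \<epsilon>) s) \<in> rels0"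
| R3: "\<lbrakk>i \<in> I; i \<noteq> 0; s \<in> J\<rbrakk> \<Longrightarrow>
    comm (x\<^sub>g \<epsilon> i zero_vec) (x\<^sub>g (opp \<epsilon>) 0 (ax (sg \<epsilon>) s)) \<in> rels0"
| R4: "\<lbrakk>i \<in> I; j \<in> I\<rbrakk> \<Longrightarrow>
    comm (x\<^sub>g Positive i zero_vec) (x\<^sub>g Negative j zero_vec)
      - (if i = j then (1 / (qq i - inverse (qq i))) *\<^sub>K (K\<^sub>g Positive i - K\<^sub>g Negative i) else 0)
      \<in> rels0"
| R4_0: "s \<in> J \<Longrightarrow>
    comm (x\<^sub>g Positive 0 (ax (-1) s)) (x\<^sub>g Negative 0 (ax 1 s))
      - (1 / (qq 0 - inverse (qq 0))) *\<^sub>K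
          (gam_half s (-2) * K\<^sub>g Positive 0 - gam_half s 2 * K\<^sub>g Negative 0) \<in> rels0"
| R5: "i \<in> I \<Longrightarrow>
    d\<^sub>g Positive * x\<^sub>g \<epsilon> i zero_vec * d\<^sub>g Negative
      - (q powi (sg \<epsilon> * (if i = 0 then 1 else 0))) *\<^sub>K x\<^sub>g \<epsilon> i zero_vec \<in> rels0"
| R5_0: "s \<in> J \<Longrightarrow>
    d\<^sub>g Positive * x\<^sub>g (opp \<epsilon>) 0 (ax (sg \<epsilon>) s) * d\<^sub>g Negative
      - (q powi (- sg \<epsilon>)) *\<^sub>K x\<^sub>g (opp \<epsilon>) 0 (ax (sg \<epsilon>) s) \<in> rels0"
| R6_0: "s \<in> J \<Longrightarrow>
    qcomm (qq 0 powi (-2)) (x\<^sub>g (opp \<epsilon>) 0 (ax (sg \<epsilon>) s)) (x\<^sub>g (opp \<epsilon>) 0 zero_vec) \<in> rels0"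
| R6: "\<lbrakk>s \<in> J; s' \<in> J; s \<noteq> s'\<rbrakk> \<Longrightarrow>
    comm (x\<^sub>g (opp \<epsilon>) 0 (ax (sg \<epsilon>) s)) (x\<^sub>g (opp \<epsilon>) 0 (ax (sg \<epsilon>) s')) \<in> rels0"
| R7: "\<lbrakk>i \<in> I; j \<in> I; i \<noteq> j; r = nat (1 - a i j)\<rbrakk> \<Longrightarrow>
    (\<Sum>t\<le>r. ((-1) ^ t * qbinom (qq i) r t) *\<^sub>K
       (x\<^sub>g \<epsilon> i zero_vec ^ (r - t) * x\<^sub>g \<epsilon> j zero_vec * x\<^sub>g \<epsilon> i zero_vec ^ t)) \<in> rels0"
| R8: "\<lbrakk>s \<in> J; j \<in> I; j \<noteq> 0; r = nat (1 - a j 0)\<rbrakk> \<Longrightarrow>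
    (\<Sum>t\<le>r. ((-1) ^ t * qbinom (qq j) r t) *\<^sub>K
       (x\<^sub>g \<epsilon> j zero_vec ^ (r - t) * x\<^sub>g \<epsilon> 0 (ax (- sg \<epsilon>) s) * x\<^sub>g \<epsilon> j zero_vec ^ t)) \<in> rels0"
| R9: "\<lbrakk>s \<in> J; j \<in> I; j \<noteq> 0; r = nat (1 - a 0 j)\<rbrakk> \<Longrightarrow>
    (\<Sum>t\<le>r. ((-1) ^ t * qbinom (qq 0) r t) *\<^sub>K
       (x\<^sub>g \<epsilon> 0 (ax (- sg \<epsilon>) s) ^ (r - t) * x\<^sub>g \<epsilon> j zero_vec * x\<^sub>g \<epsilon> 0 (ax (- sg \<epsilon>) s) ^ t))
       \<in> rels0"
| R10: "\<lbrakk>s \<in> J; j \<in> I; j \<noteq> 0; r = nat (1 - a 0 j);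
     \<forall>p\<in>{1..r}. m p \<in> {zero_vec, ax (- sg \<epsilon>) s}\<rbrakk> \<Longrightarrow>
    (\<Sum>\<sigma> | \<sigma> permutes {1..r}. \<Sum>t\<le>r. ((-1) ^ t * qbinom (qq 0) r t) *\<^sub>K
       insert_prod r (\<lambda>p. x\<^sub>g \<epsilon> 0 (m (\<sigma> p))) (x\<^sub>g \<epsilon> j zero_vec) (r - t)) \<in> rels0"
| R11: "s \<in> J \<Longrightarrow>
    (\<Sum>t\<le>3. ((-1) ^ t * qq 0 powi (- 2 * int t) * qbinom (qq 0) 3 t) *\<^sub>K
       (x\<^sub>g \<epsilon> 0 zero_vec ^ (3 - t) * x\<^sub>g (opp \<epsilon>) 0 (ax (sg \<epsilon>) s) * x\<^sub>g \<epsilon> 0 zero_vec ^ t)) \<in> rels0"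
| R12: "s \<in> J \<Longrightarrow>
    (\<Sum>t\<le>3. ((-1) ^ t * qq 0 powi (2 * int t) * qbinom (qq 0) 3 t) *\<^sub>K
       (x\<^sub>g \<epsilon> 0 (ax (- sg \<epsilon>) s) ^ (3 - t) * x\<^sub>g (opp \<epsilon>) 0 zero_vec
          * x\<^sub>g \<epsilon> 0 (ax (- sg \<epsilon>) s) ^ t)) \<in> rels0"
| R13: "\<lbrakk>s \<in> J; s' \<in> J; s \<noteq> s'\<rbrakk> \<Longrightarrow>
    (\<Sum>t\<le>3. ((-1) ^ t * qbinom (qq 0) 3 t) *\<^sub>K
       (x\<^sub>g \<epsilon> 0 (ax (- sg \<epsilon>) s) ^ (3 - t) * x\<^sub>g (opp \<epsilon>) 0 (ax (sg \<epsilon>) s')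
          * x\<^sub>g \<epsilon> 0 (ax (- sg \<epsilon>) s) ^ t)) \<in> rels0"

definition U_0 :: "(Cq, tor_free set) module" where
  "U_0 = presented gens0 rels0"

definition canonical_epi :: "(tor_free set \<Rightarrow> tor_free set) \<Rightarrow> bool" where
  "canonical_epi \<pi> \<longleftrightarrow> \<pi> \<in> alg_epi U_0 U_tor
     \<and> (\<forall>g\<in>gens0. \<pi> (pres_class gens0 rels0 (gen g)) = pres_class tor_gens tor_rels (gen g))"

end

end

theory Submission
  imports Defs
begin

text \<open>Every defining relation of the small algebra holds in the toroidal one. Most are special cases
  of toroidal relations; in the cubic relations (11) and (12), repeated twisted commutation with
  \<open>x\<^sub>0\<^sup>\<plusminus>(m)\<close> turns \<open>x\<^sub>0\<^sup>\<mp>(m')\<close> first into a multiple of \<open>a\<^sub>0\<^sup>(\<^sup>s\<^sup>)(\<plusminus>1)\<close>, then into a multiple of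
  a neighbouring \<open>x\<^sub>0\<^sup>\<plusminus>(m \<plusminus> e\<^sub>s)\<close>, and finally into zero. Surjectivity: the generators at the affine node
  produce \<open>a\<^sub>0\<^sup>(\<^sup>s\<^sup>)(\<plusminus>1)\<close>, whose commutators move \<open>x\<^sub>j\<^sup>\<plusminus>\<close> along every axis whenever
  \<open>a\<^sub>0\<^sub>j \<noteq> 0\<close>; commuting \<open>x\<^sub>j\<^sup>+\<close> with \<open>x\<^sub>j\<^sup>-\<close> then yields all \<open>a\<^sub>j\<^sup>(\<^sup>s\<^sup>)(l)\<close>, and one proceeds
  from node to node because the affine Dynkin diagram is connected. Connectedness in turn follows
  from simplicity: a component avoiding the affine node would generate a proper ideal.\<close>

text \<open>The obstacle is that the small algebra has loop generators at the affine node only, and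
  for each sign in one half-direction: degree \<open>-e\<^sub>s\<close> for \<open>+\<close>, degree
  \<open>e\<^sub>s\<close> for \<open>-\<close>. Paired with the opposite generator of degree zero
  they have total degree -1 or 1, where the exponential in \<open>T8\<close> is just its linear
  term; hence \<open>a\<^sub>0\<close> of degree -1 and 1 can be isolated. Relations
  \<open>T6\<close> to \<open>T10\<close> speak of single axes, but \<open>T5\<close> holds at every
  lattice point, and this is what leads off the axes. Isolating an element always means dividing by
  a scalar or stripping powers of \<open>\<gamma>\<close> and \<open>K\<close>. The scalars are
  non-zero because \<open>q\<close> is transcendental, the \<open>d i\<close> are positive and the
  characteristic is zero; the inverses of \<open>\<gamma>\<close> and \<open>K\<close> already lie
  in the small algebra. In the cubic relations the same twist \<open>v\<close> arises twice, from
  moving \<open>x\<close> past \<open>K\<close> and past the neighbouring \<open>x\<close>, because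
  both exponents are governed by \<open>a 0 0 = 2\<close>. So the factors carry 1, \<open>v\<close>
  and \<open>v\<^sup>2\<close>, and their product has Gaussian binomials as coefficients.\<close>

section \<open>Connectedness of the affine Dynkin diagram\<close>

context complex_lie_algebra
begin

lemma lie_zero [simp]: "lie 0 x = 0" "lie x 0 = 0"
  using lie_add_left[of 0 0 x] lie_add_right[of x 0 0] by simp_all

lemma lie_antisym: "lie x y = - lie y x"
proof -
  have "lie (x + y) (x + y) = (lie x x + lie x y) + (lie y x + lie y y)"
    by (simp only: lie_add_left lie_add_right ac_simps)
  then have "lie x y + lie y x = 0" by (simp add: lie_self)
  then show ?thesis by (simp add: eq_neg_iff_add_eq_0)
qed

lemma lie_minus: "lie (- x) y = - lie x y" "lie x (- y) = - lie x y"
proof -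
  show "lie (- x) y = - lie x y"
    using lie_add_left[of "- x" x y] by (simp add: eq_neg_iff_add_eq_0)
  show "lie x (- y) = - lie x y"
    using lie_add_right[of x "- y" y] by (simp add: eq_neg_iff_add_eq_0)
qed

lemma jacobi_derivation: "lie x (lie y z) = lie (lie x y) z + lie y (lie x z)"
proof -
  have "lie y (lie z x) = - lie y (lie x z)"
    using lie_antisym[of z x] by (simp add: lie_minus)
  moreover have "lie z (lie x y) = - lie (lie x y) z" by (rule lie_antisym)
  ultimately show ?thesis using jacobi[of x y z] by (simp add: algebra_simps)
qed

lemma lie_sum_right: "lie x (\<Sum>k\<in>K. w k) = (\<Sum>k\<in>K. lie x (w k))"
  by (induction K rule: infinite_finite_induct) (simp_all add: lie_add_right)

section \<open>Eigenvectors of an adjoint operator and strings of an sl2-triple in finite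
  dimension\<close>

lemma eigenvectors_sum_zero:
  assumes "finite K" and "\<forall>k\<in>K. lie h (w k) = scale (\<mu> k) (w k)" and "inj_on \<mu> K"
    and "(\<Sum>k\<in>K. w k) = 0"
  shows "\<forall>k\<in>K. w k = 0"
  using assms
proof (induction K arbitrary: w rule: finite_induct)
  case (insert k0 K)
  \<comment> \<open>\<open>w'\<close> is the image of the family under
    \<open>lie h - \<mu> k0\<close>: the \<open>k0\<close> term dies, the others are scaled by
    non-zero factors.\<close>
  define w' where "w' = (\<lambda>k. scale (\<mu> k - \<mu> k0) (w k))"
  have eig: "\<forall>k\<in>K. lie h (w' k) = scale (\<mu> k) (w' k)"
    using insert.prems(1) by (simp add: w'_def lie_scale_right mult.commute)
  have "0 = lie h (\<Sum>k\<in>insert k0 K. w k) - scale (\<mu> k0) (\<Sum>k\<in>insert k0 K. w k)"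
    using insert.prems(3) by simp
  also have "\<dots> = (\<Sum>k\<in>insert k0 K. scale (\<mu> k) (w k)) - scale (\<mu> k0) (\<Sum>k\<in>insert k0 K. w k)"
    using insert.prems(1) unfolding lie_sum_right by (intro arg_cong2[of _ _ _ _ minus] sum.cong) blast+
  also have "\<dots> = (\<Sum>k\<in>insert k0 K. w' k)"
    by (simp add: w'_def scale_sum_right scale_left_diff_distrib sum_subtractf)
  also have "\<dots> = (\<Sum>k\<in>K. w' k)"
    using insert.hyps by (simp add: w'_def)
  finally have "(\<Sum>k\<in>K. w' k) = 0" by simp
  then have w': "\<forall>k\<in>K. w' k = 0"
    using insert.IH[OF eig] insert.prems(2) by (simp add: inj_on_def)
  have "w k = 0" if "k \<in> K" for k
  proof -
    have "\<mu> k \<noteq> \<mu> k0" using insert.prems(2) insert.hyps that by (auto simp: inj_on_def)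
    then show ?thesis using w' that by (auto simp: w'_def)
  qed
  then show ?case using insert.prems(3) insert.hyps by simp
qed simp

text \<open>Non-zero eigenvectors with distinct eigenvalues form an injective sequence with
  independent range, which a finite spanning set excludes.\<close>

lemma eigenvector_sequence_finite_dimensional:
  assumes "finite B" and "span B = UNIV"
    and eig: "\<And>k :: nat. lie h (w k) = scale (\<mu> k) (w k)" and "inj \<mu>"
  shows "\<exists>k. w k = 0"
proof (rule ccontr)
  assume nz: "\<nexists>k. w k = 0"
  have inj: "inj w"
  proof (rule injI)
    fix k l assume "w k = w l"
    then have "scale (\<mu> k) (w l) = scale (\<mu> l) (w l)"
      using eig[of k] eig[of l] by metis
    then have "\<mu> k = \<mu> l" using nz by (metis scale_cancel_right)
    then show "k = l" using \<open>inj \<mu>\<close> by (simp add: inj_eq)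
  qed
  have "independent (range w)"
  proof
    assume "dependent (range w)"
    then obtain S c where S: "finite S" "S \<subseteq> range w" "(\<Sum>v\<in>S. scale (c v) v) = 0"
      and "\<exists>v\<in>S. c v \<noteq> 0"
      unfolding dependent_explicit by blast
    obtain K where K: "S = w ` K" using S(2) by (metis subset_imageE)
    have injK: "inj_on w K" using inj by (rule inj_on_subset) simp
    have "finite K" using S(1) K injK finite_imageD by blast
    moreover have "(\<Sum>k\<in>K. scale (c (w k)) (w k)) = 0"
      using S(3) by (simp add: K sum.reindex[OF injK])
    ultimately have "\<forall>k\<in>K. scale (c (w k)) (w k) = 0"
    proof (intro eigenvectors_sum_zero[of K h "\<lambda>k. scale (c (w k)) (w k)" \<mu>] ballI)
      show "lie h (scale (c (w k)) (w k)) = scale (\<mu> k) (scale (c (w k)) (w k))" for k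
        unfolding lie_scale_right eig by (rule scale_left_commute)
      show "inj_on \<mu> K" using \<open>inj \<mu>\<close> by (rule inj_on_subset) simp
    qed
    then show False using nz \<open>\<exists>v\<in>S. c v \<noteq> 0\<close> K by auto
  qed
  then have "finite (range w)"
    using independent_span_bound[OF \<open>finite B\<close>] \<open>span B = UNIV\<close> by simp
  then show False using inj by (simp add: finite_image_iff)
qed

text \<open>The iterates of \<open>e\<close> on \<open>v\<close> have the distinct weights
  \<open>2 + 2k\<close>, so one of them vanishes; since \<open>f\<close> leads back down the string
  with non-zero factors, the vanishing descends to \<open>v\<close>.\<close>

lemma sl2_lowest_weight_eq_zero:
  assumes "finite B" and "span B = UNIV"
    and he: "lie (lie e f) e = scale 2 e"
    and fv: "lie f v = 0" and hv: "lie (lie e f) v = scale 2 v"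
  shows "v = 0"
proof -
  define w where "w = rec_nat v (\<lambda>_. lie e)"
  have w0: "w 0 = v" and wS: "w (Suc k) = lie e (w k)" for k by (simp_all add: w_def)
  have hw: "lie (lie e f) (w k) = scale (2 + 2 * of_nat k) (w k)" for k
  proof (induction k)
    case (Suc k)
    have "lie (lie e f) (w (Suc k)) = lie (lie (lie e f) e) (w k) + lie e (lie (lie e f) (w k))"
      unfolding wS by (rule jacobi_derivation)
    also have "\<dots> = scale (2 + (2 + 2 * of_nat k)) (w (Suc k))"
      unfolding he Suc.IH lie_scale_left lie_scale_right wS by (rule scale_left_distrib[symmetric])
    also have "2 + (2 + 2 * of_nat k) = (2 + 2 * of_nat (Suc k) :: complex)" by simp
    finally show ?case .
  next
    case 0
    have "2 + 2 * of_nat 0 = (2 :: complex)" by simp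
    then show ?case unfolding w0 hv by (simp only:)
  qed
  \<comment> \<open>The factor is minus the sum of the weights \<open>2 + 2l\<close> over
    \<open>l \<le> k\<close>, that is, \<open>-(k+1)(k+2)\<close>.\<close>
  have fw: "lie f (w (Suc k)) = scale (- (of_nat (Suc k) * of_nat (Suc (Suc k)))) (w k)" for k
  proof (induction k)
    case 0
    have "lie f (w (Suc 0)) = lie (lie f e) v + lie e (lie f v)"
      unfolding wS w0 by (rule jacobi_derivation)
    also have "\<dots> = - lie (lie e f) v" unfolding lie_antisym[of f e] by (simp add: fv lie_minus)
    finally show ?case by (simp add: hv w0)
  next
    case (Suc k)
    have "lie f (w (Suc (Suc k))) = lie (lie f e) (w (Suc k)) + lie e (lie f (w (Suc k)))"
      by (subst wS) (rule jacobi_derivation)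
    also have "\<dots> = - scale (2 + 2 * of_nat (Suc k)) (w (Suc k))
        + scale (- (of_nat (Suc k) * of_nat (Suc (Suc k)))) (w (Suc k))"
      unfolding Suc.IH lie_antisym[of f e] lie_minus hw lie_scale_right wS[of k, symmetric] ..
    also have "\<dots> = scale (- (2 + 2 * of_nat (Suc k)) + - (of_nat (Suc k) * of_nat (Suc (Suc k)))) (w (Suc k))"
      by (simp only: scale_minus_left scale_left_distrib)
    also have "\<dots> = scale (- (of_nat (Suc (Suc k)) * of_nat (Suc (Suc (Suc k))))) (w (Suc k))"
      by (rule arg_cong[of _ _ "\<lambda>c. scale c _"]) (simp add: algebra_simps)
    finally show ?case .
  qed
  have "inj (\<lambda>k. 2 + 2 * of_nat k :: complex)" by (simp add: inj_def)
  then obtain k where "w k = 0"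
    using eigenvector_sequence_finite_dimensional
      [OF assms(1,2), of "lie e f" w "\<lambda>k. 2 + 2 * of_nat k"] hw by blast
  moreover have "w k = 0 \<Longrightarrow> w 0 = 0" for k
  proof (induction k)
    case (Suc k)
    have "scale (- (of_nat (Suc k) * of_nat (Suc (Suc k)))) (w k) = 0"
      unfolding fw[of k, symmetric] Suc.prems by (rule lie_zero)
    then have "w k = 0"
      by (simp only: scale_eq_0_iff neg_equal_0_iff_equal mult_eq_0_iff of_nat_eq_0_iff nat.distinct)
        blast
    then show ?case by (rule Suc.IH)
  qed
  ultimately show ?thesis by (simp add: w0)
qed

section \<open>Root spaces, centralizers and normalizers\<close>

lemma root_space_lie:
  assumes "x \<in> root_space H \<alpha>" and "y \<in> root_space H \<beta>"
  shows "lie x y \<in> root_space H (\<lambda>h. \<alpha> h + \<beta> h)"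
  using assms
  by (simp add: root_space_def jacobi_derivation[of _ x y] lie_scale_left lie_scale_right
      scale_left_distrib)

text \<open>Since centralizers and normalizers are subalgebras, commuting with an element or
  normalizing a subalgebra need only be checked on generators.\<close>

lemma centralizer_subalgebra: "lie_subalgebra {x. lie x y = 0}"
  unfolding lie_subalgebra_def
proof (intro conjI ballI)
  show "subspace {x. lie x y = 0}"
    by (rule subspaceI) (simp_all add: lie_add_left lie_scale_left)
  fix u v assume "u \<in> {x. lie x y = 0}" "v \<in> {x. lie x y = 0}"
  then have "lie u y = 0" "lie v y = 0" by simp_all
  then show "lie u v \<in> {x. lie x y = 0}"
    using jacobi_derivation[of u v y] by simp
qed

lemma normalizer_subalgebra:
  assumes "lie_subalgebra M"
  shows "lie_subalgebra {x. \<forall>m\<in>M. lie x m \<in> M}"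
  unfolding lie_subalgebra_def
proof (intro conjI ballI)
  have M: "subspace M" using assms by (simp add: lie_subalgebra_def)
  show "subspace {x. \<forall>m\<in>M. lie x m \<in> M}"
    using M by (intro subspaceI) (simp_all add: lie_add_left lie_scale_left subspace_0
        subspace_add subspace_scale)
  fix u v assume uv: "u \<in> {x. \<forall>m\<in>M. lie x m \<in> M}" "v \<in> {x. \<forall>m\<in>M. lie x m \<in> M}"
  have "lie (lie u v) m \<in> M" if "m \<in> M" for m
  proof -
    have "lie (lie u v) m = lie u (lie v m) - lie v (lie u m)"
      using jacobi_derivation[of u v m] by simp
    then show ?thesis using uv that M by (simp add: subspace_diff)
  qed
  then show "lie u v \<in> {x. \<forall>m\<in>M. lie x m \<in> M}" by simp
qed

lemma Inter_subalgebra: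
  assumes "\<And>M. M \<in> \<M> \<Longrightarrow> lie_subalgebra M"
  shows "lie_subalgebra (\<Inter>\<M>)"
  using assms unfolding lie_subalgebra_def by (auto intro: subspace_Inter)

lemma simple_roots_coefficients:
  assumes "simple_roots H n \<alpha>" and "is_root H \<beta>"
  shows "\<exists>c :: nat \<Rightarrow> int. ((\<forall>i\<in>{1..n}. 0 \<le> c i) \<or> (\<forall>i\<in>{1..n}. c i \<le> 0))
    \<and> (\<forall>h\<in>H. \<beta> h = (\<Sum>i=1..n. of_int (c i) * \<alpha> i h))"
  using assms unfolding simple_roots_def by blast

text \<open>Otherwise \<open>\<alpha> i - \<alpha> j\<close> would be a root. By linear independence
  its coefficients are 1 at \<open>i\<close> and -1 at \<open>j\<close>, against the common sign
  demanded of the coefficients of a root.\<close>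

lemma lie_commute_simple_roots:
  assumes "simple_roots H n \<alpha>" and ij: "i \<in> {1..n}" "j \<in> {1..n}" "i \<noteq> j"
    and x: "x \<in> root_space H (\<alpha> i)" and y: "y \<in> root_space H (\<lambda>h. - \<alpha> j h)"
  shows "lie x y = 0"
proof (rule ccontr)
  assume nz: "lie x y \<noteq> 0"
  let ?\<beta> = "\<lambda>h. \<alpha> i h + - \<alpha> j h"
  have roots: "is_root H (\<alpha> i)" "is_root H (\<alpha> j)"
    and indep: "\<And>c :: nat \<Rightarrow> complex. \<forall>h\<in>H. (\<Sum>i=1..n. c i * \<alpha> i h) = 0 \<Longrightarrow> \<forall>i\<in>{1..n}. c i = 0"
    using assms(1) ij by (auto simp: simple_roots_def)
  define c :: "nat \<Rightarrow> complex" where "c = (\<lambda>k. if k = i then 1 else if k = j then - 1 else 0)"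
  have c: "(\<Sum>k=1..n. c k * \<alpha> k h) = ?\<beta> h" for h
  proof -
    have "(\<Sum>k=1..n. c k * \<alpha> k h)
        = (\<Sum>k=1..n. (if k = i then \<alpha> k h else 0) + (if k = j then - \<alpha> k h else 0))"
      using ij by (intro sum.cong) (auto simp: c_def)
    also have "\<dots> = ?\<beta> h" using ij by (simp add: sum.distrib)
    finally show ?thesis .
  qed
  have "\<exists>h\<in>H. ?\<beta> h \<noteq> 0"
    using indep[of c] ij unfolding c by (force simp: c_def)
  moreover have "root_space H ?\<beta> \<noteq> {0}"
    using root_space_lie[OF x y] nz by auto
  ultimately have "is_root H ?\<beta>"
    using roots by (auto simp: is_root_def algebra_simps)
  from simple_roots_coefficients[OF assms(1) this] obtain b :: "nat \<Rightarrow> int"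
    where sign: "(\<forall>i\<in>{1..n}. 0 \<le> b i) \<or> (\<forall>i\<in>{1..n}. b i \<le> 0)"
      and b: "\<forall>h\<in>H. ?\<beta> h = (\<Sum>i=1..n. of_int (b i) * \<alpha> i h)"
    by blast
  have "\<forall>k\<in>{1..n}. of_int (b k) - c k = 0"
  proof (rule indep)
    show "\<forall>h\<in>H. (\<Sum>k=1..n. (of_int (b k) - c k) * \<alpha> k h) = 0"
      using b by (simp add: left_diff_distrib sum_subtractf c del: One_nat_def)
  qed
  then have "of_int (b i) = (1 :: complex)" "of_int (b j) = (- 1 :: complex)"
    using ij by (auto simp: c_def)
  then have "b i = 1" "b j = - 1"
    by (simp, metis of_int_eq_iff of_int_minus of_int_1)
  then show False using sign ij by force
qed

end

section \<open>From simplicity to a connected diagram\<close>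

context simple_lie_algebra
begin

text \<open>The vector \<open>lie e x\<close> is killed by \<open>f\<close> and has weight 2, so the
  string argument annihilates it. This yields the Serre relation for a vanishing Cartan
  entry.\<close>

lemma lie_zero_of_orthogonal:
  assumes he: "lie (lie e f) e = scale 2 e" and hx: "lie (lie e f) x = 0" and fx: "lie f x = 0"
  shows "lie e x = 0"
proof -
  obtain B where B: "finite B" "span B = UNIV" using finite_dimensional by blast
  have "lie f (lie e x) = - lie (lie e f) x"
    using lie_antisym[of f e] by (simp add: jacobi_derivation[of f e x] fx lie_minus)
  moreover have "lie (lie e f) (lie e x) = scale 2 (lie e x)"
    by (simp add: jacobi_derivation[of "lie e f" e x] he hx lie_scale_left)
  ultimately show ?thesis
    using sl2_lowest_weight_eq_zero[OF B he] by (simp add: hx)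
qed

lemma affine_cartan_matrix_diagonal:
  assumes "affine_cartan_matrix n a" and "i \<in> {0..n}"
  shows "a i i = 2"
proof -
  have "(of_int (a i i) :: complex) = of_int 2"
    using assms unfolding affine_cartan_matrix_def by force
  then show ?thesis by (simp only: of_int_eq_iff)
qed

text \<open>Let \<open>M\<close> be generated by the \<open>e i\<close> and \<open>f i\<close> with
  \<open>i\<close> outside \<open>S\<close>. The Chevalley generators of the nodes in
  \<open>S\<close> commute with \<open>M\<close>, the remaining ones lie in \<open>M\<close>; so
  \<open>M\<close> is normalized by everything and is a non-zero ideal. It is proper because it
  commutes with the generators of a node \<open>j0\<close> in \<open>S\<close>.\<close>

lemma affine_cartan_matrix_connected:
  assumes "affine_cartan_matrix n a"
    and sym: "\<And>i j. i \<in> {0..n} \<Longrightarrow> j \<in> {0..n} \<Longrightarrow> a i j = 0 \<Longrightarrow> a j i = 0"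
    and "0 \<in> S" and closed: "\<And>i j. i \<in> S \<inter> {0..n} \<Longrightarrow> j \<in> {0..n} \<Longrightarrow> a i j \<noteq> 0 \<Longrightarrow> j \<in> S"
  shows "{0..n} \<subseteq> S"
proof (rule ccontr)
  assume not_all: "\<not> {0..n} \<subseteq> S"
  obtain H \<alpha> e f where
    cartan: "cartan_subalgebra H" and simple: "simple_roots H n \<alpha>"
    and highest: "highest_root H n \<alpha> (\<lambda>h. - \<alpha> 0 h)"
    and ef: "\<And>i. i \<in> {0..n} \<Longrightarrow> e i \<in> root_space H (\<alpha> i) \<and> f i \<in> root_space H (\<lambda>h. - \<alpha> i h)
      \<and> \<alpha> i (lie (e i) (f i)) = 2"
    and gen: "lie_generates (e ` {1..n} \<union> f ` {1..n})"
    and a: "\<And>i j. i \<in> {0..n} \<Longrightarrow> j \<in> {0..n} \<Longrightarrow> of_int (a i j) = \<alpha> j (lie (e i) (f i))"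
    using assms(1) unfolding affine_cartan_matrix_def by blast
  have HN: "{x. \<forall>h\<in>H. lie x h \<in> H} = H" and "subspace H"
    using cartan by (auto simp: cartan_subalgebra_def lie_subalgebra_def)
  then have "0 \<in> H" by (simp add: subspace_0)
  \<comment> \<open>The coroot has weight zero, so it normalizes \<open>H\<close>, and a Cartan
    subalgebra is its own normalizer.\<close>
  have h_in: "lie (e i) (f i) \<in> H" if "i \<in> {0..n}" for i
  proof -
    have "lie (e i) (f i) \<in> root_space H (\<lambda>h. \<alpha> i h + - \<alpha> i h)"
      using root_space_lie ef[OF that] by blast
    then have "\<forall>h\<in>H. lie h (lie (e i) (f i)) = 0" by (simp add: root_space_def)
    then have "\<forall>h\<in>H. lie (lie (e i) (f i)) h = 0"
      using lie_antisym by (metis neg_equal_0_iff_equal)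
    then show ?thesis using HN \<open>0 \<in> H\<close> by auto
  qed
  have he: "lie (lie (e i) (f i)) (e j) = scale (of_int (a i j)) (e j)"
    and hf: "lie (lie (e i) (f i)) (f j) = scale (- of_int (a i j)) (f j)"
    if "i \<in> {0..n}" "j \<in> {0..n}" for i j
    using ef[OF that(2)] h_in[OF that(1)] a[OF that] by (simp_all add: root_space_def)
  \<comment> \<open>\<open>S\<close> must contain a node of the finite diagram as well. There is one
    next to the affine node: \<open>\<alpha> 0\<close> is a combination of the other simple roots
    and takes the value 2 on its own coroot.\<close>
  have "\<exists>j\<in>{1..n}. a 0 j \<noteq> 0"
  proof (rule ccontr)
    assume "\<not> ?thesis"
    then have zero: "\<forall>j\<in>{1..n}. \<alpha> j (lie (e 0) (f 0)) = 0"
      using a[of 0] by force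
    have "is_root H (\<lambda>h. - \<alpha> 0 h)" using highest by (simp add: highest_root_def)
    from simple_roots_coefficients[OF simple this] obtain c :: "nat \<Rightarrow> int"
      where "\<forall>h\<in>H. - \<alpha> 0 h = (\<Sum>i=1..n. of_int (c i) * \<alpha> i h)" by blast
    then have "- \<alpha> 0 (lie (e 0) (f 0)) = 0" using h_in[of 0] zero by simp
    then show False using ef[of 0] by simp
  qed
  then obtain j0 where j0: "j0 \<in> {1..n}" "a 0 j0 \<noteq> 0" by blast
  then have "j0 \<in> S" using closed[of 0 j0] \<open>0 \<in> S\<close> by simp
  \<comment> \<open>As \<open>0 \<in> S\<close>, all these nodes lie in \<open>{1..n}\<close>, so
    both kinds of generators of \<open>X\<close> are Chevalley generators and the simple-root
    argument applies to them.\<close>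
  define X where "X = e ` ({0..n} - S) \<union> f ` ({0..n} - S)"
  have comm: "lie x (e j) = 0" "lie x (f j) = 0"
    if x: "x \<in> X" and j: "j \<in> S" "j \<in> {1..n}" for x j
  proof -
    obtain i where i: "i \<in> {0..n}" "i \<notin> S" "x = e i \<or> x = f i"
      using x by (auto simp: X_def)
    have i1: "i \<in> {1..n}" "i \<noteq> j" "j \<in> {0..n}" using i j \<open>0 \<in> S\<close> by (auto intro: Suc_leI gr0I)
    have aij: "a j i = 0" "a i j = 0" using closed[of j i] i j i1 sym[of j i] by auto
    have efij: "lie (e i) (f j) = 0" "lie (e j) (f i) = 0"
      using lie_commute_simple_roots[OF simple] i1 j ef i(1) by metis+
    have fe: "lie (f i) (e j) = 0" using efij(2) lie_antisym[of "f i" "e j"] by simp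
    have "lie (e i) (e j) = 0"
    proof (rule lie_zero_of_orthogonal)
      show "lie (lie (e i) (f i)) (e i) = scale 2 (e i)"
        using he[OF i(1) i(1)] a[OF i(1) i(1)] ef[OF i(1)] by simp
    qed (use he[OF i(1) i1(3)] aij fe in simp_all)
    \<comment> \<open>Here \<open>f i\<close> plays the part of \<open>e\<close> and
      \<open>e i\<close> that of \<open>f\<close>, which negates the coroot.\<close>
    moreover have "lie (f i) (f j) = 0"
    proof (rule lie_zero_of_orthogonal)
      have neg: "lie (f i) (e i) = - lie (e i) (f i)" by (rule lie_antisym)
      show "lie (lie (f i) (e i)) (f i) = scale 2 (f i)"
        using hf[OF i(1) i(1)] a[OF i(1) i(1)] ef[OF i(1)] by (simp add: neg lie_minus)
      show "lie (lie (f i) (e i)) (f j) = 0"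
        using hf[OF i(1) i1(3)] aij by (simp add: neg lie_minus)
    qed (rule efij)
    ultimately show "lie x (e j) = 0" "lie x (f j) = 0" using i(3) fe efij by auto
  qed
  define M where "M = \<Inter>{M. lie_subalgebra M \<and> X \<subseteq> M}"
  have M: "lie_subalgebra M" unfolding M_def by (rule Inter_subalgebra) simp
  have "X \<subseteq> M" by (auto simp: M_def)
  have M_min: "M \<subseteq> M'" if "lie_subalgebra M'" "X \<subseteq> M'" for M'
    using that by (auto simp: M_def)
  have M_comm: "lie x (e j) = 0" "lie x (f j) = 0" if "x \<in> M" "j \<in> S" "j \<in> {1..n}" for x j
  proof -
    have "X \<subseteq> {x. lie x (e j) = 0}" "X \<subseteq> {x. lie x (f j) = 0}"
      using comm that(2,3) by blast+
    then show "lie x (e j) = 0" "lie x (f j) = 0"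
      using M_min[OF centralizer_subalgebra] that(1) by blast+
  qed
  have "0 \<in> M" using M by (simp add: lie_subalgebra_def subspace_0)
  have "{x. \<forall>m\<in>M. lie x m \<in> M} = UNIV"
  proof -
    have "e i \<in> {x. \<forall>m\<in>M. lie x m \<in> M} \<and> f i \<in> {x. \<forall>m\<in>M. lie x m \<in> M}"
      if "i \<in> {1..n}" for i
    proof (cases "i \<in> S")
      case True
      have "\<forall>m\<in>M. lie (e i) m = 0 \<and> lie (f i) m = 0"
        using M_comm[OF _ True that] lie_antisym by (metis neg_equal_0_iff_equal)
      then show ?thesis using \<open>0 \<in> M\<close> by simp
    next
      case False
      then have "e i \<in> M \<and> f i \<in> M" using that \<open>X \<subseteq> M\<close> by (auto simp: X_def)
      then show ?thesis using M by (simp add: lie_subalgebra_def)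
    qed
    then show ?thesis
      using gen normalizer_subalgebra[OF M] unfolding lie_generates_def by (meson Un_least image_subsetI)
  qed
  then have "lie_ideal M" using M by (auto simp: lie_ideal_def lie_subalgebra_def)
  moreover have "M \<noteq> {0}"
  proof -
    obtain i where i: "i \<in> {0..n}" "i \<notin> S" using not_all by blast
    then have "e i \<in> M" using \<open>X \<subseteq> M\<close> by (auto simp: X_def)
    moreover have "e i \<noteq> 0"
    proof
      assume "e i = 0"
      moreover have "is_root H (\<alpha> i)"
        using simple i \<open>0 \<in> S\<close> by (auto simp: simple_roots_def Suc_le_eq intro: gr0I)
      then have "\<alpha> i (0 + 0) = \<alpha> i 0 + \<alpha> i 0" using \<open>0 \<in> H\<close> unfolding is_root_def by blast
      ultimately show False using ef[OF i(1)] by simp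
    qed
    ultimately show ?thesis by auto
  qed
  ultimately have "M = UNIV" using no_proper_ideal by blast
  \<comment> \<open>The coroot of \<open>j0\<close> would vanish, although
    \<open>\<alpha> j0\<close> takes the value 2 on it.\<close>
  then have "lie (e j0) (f j0) = 0" using M_comm \<open>j0 \<in> S\<close> j0 by blast
  moreover have "is_root H (\<alpha> j0)" using simple j0 by (auto simp: simple_roots_def)
  then have "\<alpha> j0 (0 + 0) = \<alpha> j0 0 + \<alpha> j0 0" using \<open>0 \<in> H\<close> unfolding is_root_def by blast
  ultimately show False using ef[of j0] j0 by simp
qed

end

section \<open>Presented algebras\<close>

lemma poly_mapping_sum_singles:
  "(\<Sum>w\<in>Poly_Mapping.keys f. Poly_Mapping.single w (Poly_Mapping.lookup f w)) = f"
proof (rule poly_mapping_eqI)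
  fix v
  have "(\<Sum>w\<in>Poly_Mapping.keys f. Poly_Mapping.lookup (Poly_Mapping.single w (Poly_Mapping.lookup f w)) v)
      = (\<Sum>w\<in>Poly_Mapping.keys f. if w = v then Poly_Mapping.lookup f w else 0)"
    by (rule sum.cong) (simp_all add: lookup_single when_def)
  then show "Poly_Mapping.lookup (\<Sum>w\<in>Poly_Mapping.keys f. Poly_Mapping.single w (Poly_Mapping.lookup f w)) v
      = Poly_Mapping.lookup f v"
    by (simp add: lookup_sum in_keys_iff)
qed

interpretation scal: vector_space "scal :: Cq \<Rightarrow> 'x free_alg \<Rightarrow> 'x free_alg"
proof
  fix b c :: Cq and f g :: "'x free_alg"
  show "c *\<^sub>K (f + g) = c *\<^sub>K f + c *\<^sub>K g" "(b + c) *\<^sub>K f = b *\<^sub>K f + c *\<^sub>K f"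
    by (simp_all add: scal_def single_add distrib_left distrib_right)
  show "b *\<^sub>K (c *\<^sub>K f) = (b * c) *\<^sub>K f"
    by (simp add: scal_def mult_single flip: mult.assoc)
  show "1 *\<^sub>K f = f" by (simp add: scal_def)
qed

lemma scal_mult_left: "(c *\<^sub>K f) * g = c *\<^sub>K (f * g)"
  by (simp add: scal_def mult.assoc)

text \<open>The convolution product is not commutative, but scalars sit at the empty word, which is
  neutral on both sides; so the claim holds monomial by monomial.\<close>

lemma single_zero_commute: "Poly_Mapping.single 0 c * f = f * Poly_Mapping.single 0 (c :: Cq)"
  for f :: "'x free_alg"
proof -
  let ?f = "\<Sum>w\<in>Poly_Mapping.keys f. Poly_Mapping.single w (Poly_Mapping.lookup f w)"
  have "Poly_Mapping.single 0 c * ?f = ?f * Poly_Mapping.single 0 c"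
    unfolding sum_distrib_left sum_distrib_right
    by (rule sum.cong) (simp_all add: mult_single mult.commute)
  then show ?thesis by (simp only: poly_mapping_sum_singles)
qed

lemma scal_mult_right: "f * (c *\<^sub>K g) = c *\<^sub>K (f * g)"
  by (simp add: scal_def single_zero_commute[of c] mult.assoc)

lemmas scal_simps = scal_mult_left scal_mult_right scal.scale_right_distrib
  scal.scale_right_diff_distrib scal.scale_left_distrib scal.scale_left_diff_distrib

abbreviation FA :: "'x set \<Rightarrow> 'x free_alg set" where
  "FA G \<equiv> carrier (free_algebra G)"

lemma free_algebra_sel [simp]:
  "mult (free_algebra G) = (*)" "one (free_algebra G) = 1" "zero (free_algebra G) = 0"
  "add (free_algebra G) = (+)" "smult (free_algebra G) = (*\<^sub>K)"
  by (simp_all add: free_algebra_def)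

lemma FA_iff: "f \<in> FA G \<longleftrightarrow> (\<forall>w\<in>Poly_Mapping.keys f. set (letters w) \<subseteq> G)"
  by (simp add: free_algebra_def)

lemma FA_mono: "G \<subseteq> G' \<Longrightarrow> FA G \<subseteq> FA G'"
  unfolding subset_iff FA_iff by blast

lemma FA_single: "set (letters w) \<subseteq> G \<Longrightarrow> Poly_Mapping.single w c \<in> FA G"
  by (auto simp: FA_iff)

lemma FA_zero [simp]: "0 \<in> FA G"
  by (simp add: FA_iff)

lemma FA_one [simp]: "1 \<in> FA G"
  unfolding single_one[symmetric] by (rule FA_single) (simp add: zero_free_word_def)

lemma FA_add [simp]: "f \<in> FA G \<Longrightarrow> g \<in> FA G \<Longrightarrow> f + g \<in> FA G"
  using keys_add[of f g] by (force simp: FA_iff)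

lemma FA_uminus [simp]: "f \<in> FA G \<Longrightarrow> - f \<in> FA G"
  by (simp add: FA_iff)

lemma FA_diff [simp]: "f \<in> FA G \<Longrightarrow> g \<in> FA G \<Longrightarrow> f - g \<in> FA G"
  using FA_add[of f G "- g"] by simp

lemma FA_mult [simp]: 
  assumes "f \<in> FA G" "g \<in> FA G" 
  shows "f * g \<in> FA G"
  unfolding FA_iff
proof
  fix w assume "w \<in> Poly_Mapping.keys (f * g)"
  then obtain u v where "w = u + v" "u \<in> Poly_Mapping.keys f" "v \<in> Poly_Mapping.keys g"
    using keys_mult[of f g] by blast
  then show "set (letters w) \<subseteq> G"
    using assms by (auto simp: FA_iff plus_free_word_def)
qed

lemma FA_scal [simp]: "f \<in> FA G \<Longrightarrow> c *\<^sub>K f \<in> FA G"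
  unfolding scal_def by (intro FA_mult FA_single) (simp add: zero_free_word_def)

lemma FA_gen [simp]: "g \<in> G \<Longrightarrow> gen g \<in> FA G"
  unfolding gen_def by (rule FA_single) simp

lemma FA_power [simp]: "f \<in> FA G \<Longrightarrow> f ^ k \<in> FA G"
  by (induction k) simp_all

lemma FA_sum: "(\<And>i. i \<in> A \<Longrightarrow> f i \<in> FA G) \<Longrightarrow> sum f A \<in> FA G"
  by (induction A rule: infinite_finite_induct) simp_all

lemma FA_prod_list: "(\<And>i. i \<in> set is \<Longrightarrow> f i \<in> FA G) \<Longrightarrow> (\<Prod>i\<leftarrow>is. f i) \<in> FA G"
  by (induction "is") simp_all

lemma FA_qcomm [simp]: "f \<in> FA G \<Longrightarrow> g \<in> FA G \<Longrightarrow> qcomm v f g \<in> FA G"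
  by (simp add: qcomm_def)

lemma FA_insert_prod:
  assumes "\<And>p. p \<in> {1..r} \<Longrightarrow> x p \<in> FA G" and "y \<in> FA G" and "k \<le> r"
  shows "insert_prod r x y k \<in> FA G"
  unfolding insert_prod_def using assms by (intro FA_mult FA_prod_list) auto

text \<open>Every element is a finite sum of scalar multiples of words, and words are products of
  generators. The case \<open>scal_one\<close> supplies zero, one and, together with
  \<open>mult\<close>, all scalar multiples.\<close>

lemma FA_induct [consumes 1, case_names scal_one gen add mult]:
  assumes "f \<in> FA G"
    and scal_one: "\<And>c. P (c *\<^sub>K 1)" and gen: "\<And>g. g \<in> G \<Longrightarrow> P (gen g)"
    and add: "\<And>f g. f \<in> FA G \<Longrightarrow> g \<in> FA G \<Longrightarrow> P f \<Longrightarrow> P g \<Longrightarrow> P (f + g)"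
    and mult: "\<And>f g. f \<in> FA G \<Longrightarrow> g \<in> FA G \<Longrightarrow> P f \<Longrightarrow> P g \<Longrightarrow> P (f * g)"
  shows "P f"
proof -
  \<comment> \<open>Membership is carried along because the cases \<open>add\<close> and
    \<open>mult\<close> presuppose it of their operands.\<close>
  let ?Q = "\<lambda>f. f \<in> FA G \<and> P f"
  have scal_one': "?Q (c *\<^sub>K 1)" and gen': "g \<in> G \<Longrightarrow> ?Q (gen g)" for c g
    using scal_one gen by simp_all
  have add': "?Q f \<Longrightarrow> ?Q g \<Longrightarrow> ?Q (f + g)" and mult': "?Q f \<Longrightarrow> ?Q g \<Longrightarrow> ?Q (f * g)" for f g
    using add mult by simp_all
  have one: "?Q 1" using scal_one'[of 1] by simp
  have word: "?Q (Poly_Mapping.single (Free_Word ws) 1)" if "set ws \<subseteq> G" for ws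
    using that
  proof (induction ws)
    case Nil
    then show ?case using one by (simp flip: zero_free_word_def)
  next
    case (Cons g ws)
    have "Poly_Mapping.single (Free_Word (g # ws)) (1 :: Cq)
        = gen g * Poly_Mapping.single (Free_Word ws) 1"
      by (simp add: gen_def mult_single plus_free_word_def)
    then show ?case using Cons gen' mult' by simp
  qed
  have single: "?Q (Poly_Mapping.single w c)" if "set (letters w) \<subseteq> G" for w c
  proof -
    have "Poly_Mapping.single w c = (c *\<^sub>K 1) * Poly_Mapping.single (Free_Word (letters w)) 1"
      by (simp add: scal_def mult_single)
    then show ?thesis using word[OF that] scal_one' mult' by metis
  qed
  have zero: "?Q 0" using scal_one'[of 0] by simp
  have "?Q (\<Sum>w\<in>K. Poly_Mapping.single w (Poly_Mapping.lookup f w))"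
    if "finite K" "K \<subseteq> Poly_Mapping.keys f" for K
    using that
  proof (induction K)
    case (insert w K)
    then have "?Q (Poly_Mapping.single w (Poly_Mapping.lookup f w))"
      using \<open>f \<in> FA G\<close> by (intro single) (auto simp: FA_iff)
    then show ?case using insert add' by simp
  qed (simp add: zero)
  then show ?thesis
    using poly_mapping_sum_singles[of f] by (metis finite_keys order_refl)
qed

lemma free_algebra_ring: "ring (free_algebra G)"
proof (rule ringI)
  show "abelian_group (free_algebra G)"
  proof (rule abelian_groupI)
    fix f assume "f \<in> FA G"
    then show "\<exists>g\<in>FA G. g \<oplus>\<^bsub>free_algebra G\<^esub> f = \<zero>\<^bsub>free_algebra G\<^esub>"
      by (intro bexI[of _ "- f"]) simp_all
  qed (simp_all add: ac_simps)
  show "monoid (free_algebra G)"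
    by (rule monoidI) (simp_all add: mult.assoc)
qed (simp_all add: algebra_simps)

section \<open>Congruence modulo the relations, and presented algebras as quotients\<close>

locale presentation =
  fixes G :: "'x set" and R :: "'x free_alg set"
  assumes rels_closed: "R \<subseteq> FA G"
begin

text \<open>\<open>genideal\<close> is an intersection of ideals; \<open>rels_closed\<close> ensures
  that the carrier is among them, so that the intersection is an ideal.\<close>

definition L :: "'x free_alg set" where "L = genideal (free_algebra G) R"

lemma L_ideal: "ideal L (free_algebra G)"
  unfolding L_def by (rule ring.genideal_ideal[OF free_algebra_ring rels_closed])

lemma rels_in_L: "R \<subseteq> L"
  unfolding L_def by (rule ring.genideal_self[OF free_algebra_ring rels_closed])

lemma L_minimal: "ideal M (free_algebra G) \<Longrightarrow> R \<subseteq> M \<Longrightarrow> L \<subseteq> M"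
  unfolding L_def by (rule ring.genideal_minimal[OF free_algebra_ring])

lemma L_closed: "f \<in> L \<Longrightarrow> f \<in> FA G"
  using additive_subgroup.a_subset[OF ideal.axioms(1)[OF L_ideal]] by blast

lemma L_zero [simp]: "0 \<in> L"
  using additive_subgroup.zero_closed[OF ideal.axioms(1)[OF L_ideal]] by simp

lemma L_add: "f \<in> L \<Longrightarrow> g \<in> L \<Longrightarrow> f + g \<in> L"
  using additive_subgroup.a_closed[OF ideal.axioms(1)[OF L_ideal]] by simp

lemma L_mult_left: "f \<in> FA G \<Longrightarrow> g \<in> L \<Longrightarrow> f * g \<in> L"
  using ideal.I_l_closed[OF L_ideal] by simp

lemma L_mult_right: "f \<in> FA G \<Longrightarrow> g \<in> L \<Longrightarrow> g * f \<in> L"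
  using ideal.I_r_closed[OF L_ideal] by simp

lemma L_scal: "f \<in> L \<Longrightarrow> c *\<^sub>K f \<in> L"
  using L_mult_left[of "c *\<^sub>K 1" f] by (simp add: scal_mult_left)

lemma L_scal_iff: "c \<noteq> 0 \<Longrightarrow> c *\<^sub>K f \<in> L \<longleftrightarrow> f \<in> L"
  using L_scal[of "c *\<^sub>K f" "inverse c"] L_scal[of f c] by auto

lemma L_uminus: "f \<in> L \<Longrightarrow> - f \<in> L"
  using L_scal[of f "- 1"] by simp

lemma L_diff: "f \<in> L \<Longrightarrow> g \<in> L \<Longrightarrow> f - g \<in> L"
  using L_add[of f "- g"] L_uminus by simp

text \<open>Membership in the free algebra is built in, so that congruences can be chained, added
  and multiplied without side conditions.\<close>

definition cong :: "'x free_alg \<Rightarrow> 'x free_alg \<Rightarrow> bool" (infix "\<approx>" 50) where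
  "f \<approx> g \<longleftrightarrow> f \<in> FA G \<and> g \<in> FA G \<and> f - g \<in> L"

lemma cong_closed: "f \<approx> g \<Longrightarrow> f \<in> FA G \<and> g \<in> FA G"
  by (simp add: cong_def)

lemma cong_refl [simp]: "f \<in> FA G \<Longrightarrow> f \<approx> f"
  by (simp add: cong_def)

lemma cong_sym: "f \<approx> g \<Longrightarrow> g \<approx> f"
  using L_uminus[of "f - g"] by (simp add: cong_def)

lemma cong_trans [trans]: "f \<approx> g \<Longrightarrow> g \<approx> h \<Longrightarrow> f \<approx> h"
  using L_add[of "f - g" "g - h"] by (simp add: cong_def)

lemma cong_add: "f \<approx> f' \<Longrightarrow> g \<approx> g' \<Longrightarrow> f + g \<approx> f' + g'"
  using L_add[of "f - f'" "g - g'"] by (simp add: cong_def algebra_simps)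

lemma cong_diff: "f \<approx> f' \<Longrightarrow> g \<approx> g' \<Longrightarrow> f - g \<approx> f' - g'"
  using L_diff[of "f - f'" "g - g'"] by (simp add: cong_def algebra_simps)

lemma cong_mult: 
  assumes "f \<approx> f'" "g \<approx> g'" 
  shows "f * g \<approx> f' * g'"
proof -
  have "f * g - f' * g' = (f - f') * g + f' * (g - g')" by (simp add: algebra_simps)
  then show ?thesis using assms L_add L_mult_left L_mult_right by (simp add: cong_def)
qed

lemma cong_scal: "f \<approx> g \<Longrightarrow> c *\<^sub>K f \<approx> c *\<^sub>K g"
  using L_scal[of "f - g" c] by (simp add: cong_def scal.scale_right_diff_distrib)

lemma cong_zero_iff: "f \<approx> 0 \<longleftrightarrow> f \<in> L"
  using L_closed by (auto simp: cong_def)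

lemma cong_relation: "f - g \<in> R \<Longrightarrow> f \<in> FA G \<Longrightarrow> g \<in> FA G \<Longrightarrow> f \<approx> g"
  using rels_in_L by (auto simp: cong_def)

abbreviation cls :: "'x free_alg \<Rightarrow> 'x free_alg set" where
  "cls \<equiv> pres_class G R"

lemma cls_eq: "cls f = {l + f | l. l \<in> L}"
  by (auto simp: pres_class_def a_r_coset_def' L_def)

lemma cls_self: "f \<in> cls f"
  unfolding cls_eq using L_zero by force

lemma cls_eq_iff: "f \<in> FA G \<Longrightarrow> g \<in> FA G \<Longrightarrow> cls f = cls g \<longleftrightarrow> f \<approx> g"
proof
  assume fg: "f \<in> FA G" "g \<in> FA G" and "cls f = cls g"
  then obtain l where "f = l + g" "l \<in> L" using cls_self[of f] by (auto simp: cls_eq)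
  then show "f \<approx> g" using fg by (simp add: cong_def)
next
  have sub: "cls f \<subseteq> cls g" if "f \<approx> g" for f g
  proof
    fix x assume "x \<in> cls f"
    then obtain l where "x = l + f" "l \<in> L" by (auto simp: cls_eq)
    then have "x = (l + (f - g)) + g" by simp
    moreover have "l + (f - g) \<in> L" using that \<open>l \<in> L\<close> L_add by (simp add: cong_def)
    ultimately show "x \<in> cls g" unfolding cls_eq by blast
  qed
  assume "f \<approx> g"
  then show "cls f = cls g" using sub[of f g] sub[of g f] cong_sym by blast
qed

lemma presented_carrier: "carrier (presented G R) = cls ` FA G"
  by (auto simp: presented_def alg_quot_def FactRing_def A_RCOSETS_def' pres_class_def)

lemma presented_one: "one (presented G R) = cls 1"
  by (simp add: presented_def alg_quot_def FactRing_def pres_class_def)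

lemma presented_zero: "zero (presented G R) = cls 0"
  by (auto simp: presented_def alg_quot_def FactRing_def cls_eq L_def)

lemma presented_mult:
  "f \<in> FA G \<Longrightarrow> g \<in> FA G \<Longrightarrow> mult (presented G R) (cls f) (cls g) = cls (f * g)"
  using ideal.rcoset_mult_add[OF L_ideal, of f g]
  by (simp add: presented_def alg_quot_def FactRing_def pres_class_def L_def)

lemma presented_add:
  "f \<in> FA G \<Longrightarrow> g \<in> FA G \<Longrightarrow> add (presented G R) (cls f) (cls g) = cls (f + g)"
  using abelian_subgroup.a_rcos_sum[OF abelian_subgroupI3, of L "free_algebra G" f g]
    ideal.axioms(1)[OF L_ideal] ring.is_abelian_group[OF free_algebra_ring, of G]
  by (simp add: presented_def alg_quot_def FactRing_def pres_class_def L_def)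

text \<open>The scalar action on a quotient is a union over all representatives of the coset; the
  united cosets all coincide.\<close>

lemma presented_smult: 
  assumes "f \<in> FA G" shows "smult (presented G R) c (cls f) = cls (c *\<^sub>K f)"
proof -
  have "smult (presented G R) c (cls f) = (\<Union>x\<in>cls f. cls (c *\<^sub>K x))"
    by (simp add: presented_def alg_quot_def pres_class_def)
  also have "\<dots> = (\<Union>x\<in>cls f. cls (c *\<^sub>K f))"
  proof (rule SUP_cong)
    fix x assume "x \<in> cls f"
    then obtain l where "x = l + f" "l \<in> L" by (auto simp: cls_eq)
    then have "x \<approx> f" using assms L_closed by (auto simp: cong_def)
    then show "cls (c *\<^sub>K x) = cls (c *\<^sub>K f)"
      using cong_scal[of x f c] cls_eq_iff cong_closed by blast
  qed simp
  also have "\<dots> = cls (c *\<^sub>K f)" using cls_self[of f] by auto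
  finally show ?thesis .
qed

lemma presented_ring: "ring (presented G R)"
proof (rule ringI)
  show "abelian_group (presented G R)"
  proof (rule abelian_groupI)
    fix X assume "X \<in> carrier (presented G R)"
    then obtain f where "X = cls f" "f \<in> FA G" by (auto simp: presented_carrier)
    then show "\<exists>Y\<in>carrier (presented G R). Y \<oplus>\<^bsub>presented G R\<^esub> X = \<zero>\<^bsub>presented G R\<^esub>"
      by (intro bexI[of _ "cls (- f)"]) (simp_all add: presented_carrier presented_add presented_zero)
  qed (auto simp: presented_carrier presented_add presented_zero ac_simps)
  show "monoid (presented G R)"
    by (rule monoidI) (auto simp: presented_carrier presented_mult presented_one mult.assoc)
qed (auto simp: presented_carrier presented_mult presented_add algebra_simps)

lemma presented_smult_closed:
  "X \<in> carrier (presented G R) \<Longrightarrow> smult (presented G R) c X \<in> carrier (presented G R)"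
  by (auto simp: presented_carrier presented_smult)

end

text \<open>The ideal of the large presentation, cut down to the small free algebra, is an ideal
  containing \<open>R'\<close>; so it contains the ideal generated by \<open>R'\<close>, and sending
  cosets to cosets is well defined. Surjectivity is the hypothesis \<open>generated\<close>.\<close>

lemma presentation_epi:
  assumes "presentation G R" and "presentation G' R'" and "G' \<subseteq> G"
    and rels: "R' \<subseteq> presentation.L G R"
    and generated: "\<And>f. f \<in> FA G \<Longrightarrow> \<exists>g\<in>FA G'. presentation.cong G R f g"
  shows "\<exists>\<pi>\<in>alg_epi (presented G' R') (presented G R).
    \<forall>f\<in>FA G'. \<pi> (pres_class G' R' f) = pres_class G R f"
proof -
  interpret P: presentation G R by fact
  interpret P': presentation G' R' by fact
  have sub: "f \<in> FA G" if "f \<in> FA G'" for f using that FA_mono[OF \<open>G' \<subseteq> G\<close>] by blast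
  have "ideal (P.L \<inter> FA G') (free_algebra G')"
  proof (rule idealI[OF free_algebra_ring])
    show "subgroup (P.L \<inter> FA G') (add_monoid (free_algebra G'))"
    proof (rule group.subgroupI)
      show "group (add_monoid (free_algebra G'))"
        using abelian_group.a_group[OF ring.is_abelian_group[OF free_algebra_ring]] .
      show "P.L \<inter> FA G' \<noteq> {}" using P.L_zero FA_zero by blast
      fix f g assume f: "f \<in> P.L \<inter> FA G'"
      have "inv\<^bsub>add_monoid (free_algebra G')\<^esub> f = - f"
        by (rule monoid.inv_char[OF group.is_monoid[OF \<open>group (add_monoid (free_algebra G'))\<close>]])
          (use f in simp_all)
      then show "inv\<^bsub>add_monoid (free_algebra G')\<^esub> f \<in> P.L \<inter> FA G'"
        using f P.L_uminus by simp
      assume "g \<in> P.L \<inter> FA G'"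
      then show "f \<otimes>\<^bsub>add_monoid (free_algebra G')\<^esub> g \<in> P.L \<inter> FA G'" using f P.L_add by simp
    qed auto
  qed (use P.L_mult_left P.L_mult_right sub in simp_all)
  then have L: "P'.L \<subseteq> P.L" using P'.L_minimal rels P'.rels_closed by blast
  \<comment> \<open>All classes in this union agree when \<open>X\<close> is a coset, so the union
    is their common value and no representative has to be chosen.\<close>
  define \<pi> where "\<pi> = (\<lambda>X. \<Union>x\<in>X. P.cls x)"
  have \<pi>: "\<pi> (P'.cls f) = P.cls f" if "f \<in> FA G'" for f
  proof -
    have "P.cls x = P.cls f" if "x \<in> P'.cls f" for x
    proof -
      obtain l where "x = l + f" "l \<in> P'.L" using \<open>x \<in> P'.cls f\<close> by (auto simp: P'.cls_eq)
      then have "P.cong x f" using L \<open>f \<in> FA G'\<close> P.L_closed sub by (auto simp: P.cong_def)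
      then show ?thesis using P.cls_eq_iff P.cong_closed by blast
    qed
    then have "\<pi> (P'.cls f) = (\<Union>x\<in>P'.cls f. P.cls f)"
      unfolding \<pi>_def by (intro SUP_cong) simp_all
    then show ?thesis using P'.cls_self[of f] by auto
  qed
  have "\<pi> \<in> alg_hom (presented G' R') (presented G R)"
    unfolding alg_hom_def
  proof (intro CollectI conjI allI ballI ring_hom_memI)
    show "\<pi> \<one>\<^bsub>presented G' R'\<^esub> = \<one>\<^bsub>presented G R\<^esub>"
      by (simp add: P.presented_one P'.presented_one \<pi>)
  qed (auto simp: P.presented_carrier P'.presented_carrier P.presented_mult P'.presented_mult
      P.presented_add P'.presented_add P.presented_smult P'.presented_smult \<pi> sub)
  moreover have "\<pi> ` carrier (presented G' R') = carrier (presented G R)"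
  proof -
    have "P.cls f \<in> P.cls ` FA G'" if "f \<in> FA G" for f
      using generated[OF that] P.cls_eq_iff sub that by (metis imageI)
    then show ?thesis
      unfolding P.presented_carrier P'.presented_carrier image_image
      using \<pi> sub by (auto cong: image_cong_simp)
  qed
  ultimately show ?thesis using \<pi> by (auto simp: alg_epi_def)
qed

text \<open>The isomorphism sends an element of the target to its fibre, which is a coset of the kernel.\<close>

lemma alg_first_isomorphism:
  fixes A :: "('k, 'a) module" and B :: "('k, 'b) module"
  assumes "ring A" and "ring B" and \<pi>: "\<pi> \<in> alg_epi A B"
    and smult: "\<And>c x. x \<in> carrier A \<Longrightarrow> smult A c x \<in> carrier A"
  shows "alg_isomorphic B (alg_quot A (a_kernel A B \<pi>))"
proof -
  interpret A: ring A by fact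
  interpret B: ring B by fact
  interpret h: ring_hom_ring A B \<pi>
    using \<pi> by unfold_locales (simp add: alg_epi_def alg_hom_def)
  have \<pi>_smult: "\<pi> (c \<odot>\<^bsub>A\<^esub> x) = c \<odot>\<^bsub>B\<^esub> \<pi> x" if "x \<in> carrier A" for c x
    using \<pi> that by (simp add: alg_epi_def alg_hom_def)
  have surj: "\<pi> ` carrier A = carrier B" using \<pi> by (simp add: alg_epi_def)
  let ?K = "a_kernel A B \<pi>"
  define \<Phi> where "\<Phi> = (\<lambda>y. {x \<in> carrier A. \<pi> x = y})"
  have coset: "?K +>\<^bsub>A\<^esub> x = \<Phi> (\<pi> x)" if "x \<in> carrier A" for x
  proof
    show "?K +>\<^bsub>A\<^esub> x \<subseteq> \<Phi> (\<pi> x)"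
    proof
      fix z assume "z \<in> ?K +>\<^bsub>A\<^esub> x"
      then obtain k where "z = k \<oplus>\<^bsub>A\<^esub> x" "k \<in> carrier A" "\<pi> k = \<zero>\<^bsub>B\<^esub>"
        unfolding a_r_coset_def' a_kernel_def' by blast
      then show "z \<in> \<Phi> (\<pi> x)" using that by (simp add: \<Phi>_def)
    qed
    show "\<Phi> (\<pi> x) \<subseteq> ?K +>\<^bsub>A\<^esub> x"
    proof
      fix z assume "z \<in> \<Phi> (\<pi> x)"
      then have z: "z \<in> carrier A" "\<pi> z = \<pi> x" by (auto simp: \<Phi>_def)
      have "z \<ominus>\<^bsub>A\<^esub> x \<in> ?K"
        unfolding a_kernel_def' using z that by (simp add: A.minus_eq B.r_neg)
      moreover have "z = (z \<ominus>\<^bsub>A\<^esub> x) \<oplus>\<^bsub>A\<^esub> x"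
        using z that by (simp add: A.minus_eq A.a_assoc A.l_neg)
      ultimately show "z \<in> ?K +>\<^bsub>A\<^esub> x" unfolding a_r_coset_def' by blast
    qed
  qed
  have K: "ideal ?K A" by (rule h.kernel_is_ideal)
  have fin: "\<exists>x\<in>carrier A. \<pi> x = y" if "y \<in> carrier B" for y
    using that surj by (metis imageE)
  have "\<Phi> \<in> alg_hom B (alg_quot A ?K)"
    unfolding alg_hom_def
  proof (intro CollectI conjI allI ballI ring_hom_memI)
    fix y assume "y \<in> carrier B"
    then obtain x where x: "x \<in> carrier A" "y = \<pi> x" using fin by blast
    then show "\<Phi> y \<in> carrier (alg_quot A ?K)"
      by (auto simp: alg_quot_def FactRing_def A_RCOSETS_def' simp flip: coset)
    have "smult (alg_quot A ?K) c (\<Phi> y) = (\<Union>z\<in>\<Phi> y. \<Phi> (c \<odot>\<^bsub>B\<^esub> y))" for c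
      using smult by (auto simp: alg_quot_def \<Phi>_def coset \<pi>_smult)
    moreover have "x \<in> \<Phi> y" using x by (simp add: \<Phi>_def)
    ultimately show "\<Phi> (c \<odot>\<^bsub>B\<^esub> y) = c \<odot>\<^bsub>alg_quot A ?K\<^esub> \<Phi> y" for c by auto
    fix y' assume "y' \<in> carrier B"
    then obtain x' where x': "x' \<in> carrier A" "y' = \<pi> x'" using fin by blast
    show "\<Phi> (y \<otimes>\<^bsub>B\<^esub> y') = \<Phi> y \<otimes>\<^bsub>alg_quot A ?K\<^esub> \<Phi> y'"
      using ideal.rcoset_mult_add[OF K x(1) x'(1)] x x'
      by (simp add: alg_quot_def FactRing_def coset)
    show "\<Phi> (y \<oplus>\<^bsub>B\<^esub> y') = \<Phi> y \<oplus>\<^bsub>alg_quot A ?K\<^esub> \<Phi> y'"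
      using abelian_subgroup.a_rcos_sum[OF abelian_subgroupI3, of ?K A x x'] x x'
        ideal.axioms(1)[OF K] A.is_abelian_group
      by (simp add: alg_quot_def FactRing_def coset)
  next
    show "\<Phi> \<one>\<^bsub>B\<^esub> = \<one>\<^bsub>alg_quot A ?K\<^esub>"
      using coset[OF A.one_closed] by (simp add: alg_quot_def FactRing_def)
  qed
  moreover have "bij_betw \<Phi> (carrier B) (carrier (alg_quot A ?K))"
    unfolding bij_betw_def
  proof
    show "inj_on \<Phi> (carrier B)"
    proof (rule inj_onI)
      fix y y' assume "y \<in> carrier B" "y' \<in> carrier B" "\<Phi> y = \<Phi> y'"
      then obtain x where "x \<in> \<Phi> y" "x \<in> \<Phi> y'" using fin by (force simp: \<Phi>_def)
      then show "y = y'" by (simp add: \<Phi>_def)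
    qed
    have "carrier (alg_quot A ?K) = (\<lambda>x. \<Phi> (\<pi> x)) ` carrier A"
      by (auto simp: alg_quot_def FactRing_def A_RCOSETS_def' coset)
    then show "\<Phi> ` carrier B = carrier (alg_quot A ?K)"
      by (simp add: image_image flip: surj)
  qed
  ultimately show ?thesis unfolding alg_isomorphic_def by blast
qed

section \<open>Quantum integers at a generic parameter\<close>

text \<open>Characteristic zero is what allows dividing by 2, by \<open>fact r\<close> when a
  symmetrization is undone, and by the degree \<open>l\<close> in \<open>acoef\<close>.\<close>

lemma of_nat_Cq_nonzero: "0 < k \<Longrightarrow> (of_nat k :: Cq) \<noteq> 0"
proof -
  have "(of_nat k :: Cq) = Fract (of_nat k) 1"
    by (induction k) (simp_all add: Zero_fract_def One_fract_def)
  then show "0 < k \<Longrightarrow> (of_nat k :: Cq) \<noteq> 0"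
    by (simp add: Zero_fract_def eq_fract)
qed

lemma of_int_Cq_nonzero: "l \<noteq> 0 \<Longrightarrow> (of_int l :: Cq) \<noteq> 0"
  using of_nat_Cq_nonzero[of "nat \<bar>l\<bar>"]
  by (cases "0 \<le> l") (auto simp: of_nat_nat)

lemma q_nonzero: "q \<noteq> 0"
  by (simp add: q_def Zero_fract_def eq_fract)

text \<open>\<open>q\<close> is the indeterminate, so equality would be one of polynomials, and
  evaluation at 0 refutes it.\<close>

lemma q_power_neq_one: 
  assumes "0 < k" shows "q ^ k \<noteq> 1"
proof
  have "q ^ k = Fract ([:0, 1:] ^ k) 1" by (induction k) (simp_all add: q_def One_fract_def)
  moreover assume "q ^ k = 1"
  ultimately have "[:0, 1 :: complex:] ^ k = 1" by (simp add: One_fract_def eq_fract)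
  then have "poly ([:0, 1 :: complex:] ^ k) 0 = poly 1 0" by simp
  then show False using assms by (simp add: power_0_left)
qed

lemma q_power_powi_neq_one: 
  assumes "0 < k" "m \<noteq> 0" shows "(q ^ k) powi m \<noteq> 1"
proof -
  have pos: "(q ^ k) powi (int j) \<noteq> 1" if "0 < j" for j
    using q_power_neq_one[of "k * j"] that assms by (simp add: power_mult)
  show ?thesis
  proof (cases "0 < m")
    case True
    then show ?thesis using pos[of "nat m"] by simp
  next
    case False
    then have "(q ^ k) powi (- m) \<noteq> 1" using pos[of "nat (- m)"] assms by simp
    then show ?thesis by (simp add: power_int_minus)
  qed
qed

text \<open>If a power of \<open>q ^ k\<close> equalled its inverse, its square would be 1, although
  \<open>q\<close> is no root of unity.\<close>

lemma generic_difference_nonzero: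
  assumes "0 < k" "m \<noteq> 0" shows "(q ^ k) powi m - (q ^ k) powi (- m) \<noteq> 0"
proof
  have nz: "(q ^ k) powi m \<noteq> 0" using q_nonzero by simp
  assume "(q ^ k) powi m - (q ^ k) powi (- m) = 0"
  then have "(q ^ k) powi m * (q ^ k) powi m = (q ^ k) powi m * inverse ((q ^ k) powi m)"
    by (simp add: power_int_minus)
  then have "(q ^ k) powi m * (q ^ k) powi m = 1" by (simp only: Fields.right_inverse[OF nz])
  then have "(q ^ k) powi (m + m) = 1" using q_nonzero by (subst power_int_add) simp_all
  then show False using q_power_powi_neq_one[of k "m + m"] assms by simp
qed

lemma qint_nonzero: "0 < k \<Longrightarrow> m \<noteq> 0 \<Longrightarrow> qint (q ^ k) m \<noteq> 0"
  using generic_difference_nonzero[of k m] generic_difference_nonzero[of k 1]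
  by (simp add: qint_def power_int_minus)

lemma qbinom_symmetric: "k \<le> r \<Longrightarrow> qbinom v r (r - k) = qbinom v r k"
  by (simp add: qbinom_def mult.commute)

text \<open>Quantum factorials can be cancelled since \<open>v\<close> is no root of unity. What
  remains in the middle is the quantum integer 3, found by dividing
  \<open>v ^ 3 - inverse (v ^ 3)\<close> by \<open>v - inverse v\<close>.\<close>

lemma qbinom_three:
  assumes "0 < k" and v: "v = q ^ k"
  shows "qbinom v 3 0 = 1" and "qbinom v 3 1 = v\<^sup>2 + 1 + inverse (v\<^sup>2)"
    and "qbinom v 3 2 = v\<^sup>2 + 1 + inverse (v\<^sup>2)" and "qbinom v 3 3 = 1"
proof -
  have nz: "qint v m \<noteq> 0" if "m \<noteq> 0" for m
    using qint_nonzero[OF assms(1)] that v by simp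
  have v0: "v \<noteq> 0" using q_nonzero v by simp
  have d: "v - inverse v \<noteq> 0"
    using generic_difference_nonzero[of k 1] assms by (simp add: power_int_minus)
  have "(v\<^sup>2 + 1 + inverse (v\<^sup>2)) * (v - inverse v) = v ^ 3 - inverse (v ^ 3)"
    using v0 by (simp add: field_simps power2_eq_square power3_eq_cube)
  then have q3: "qint v 3 = v\<^sup>2 + 1 + inverse (v\<^sup>2)"
    using d by (simp add: qint_def power_int_minus field_simps)
  have f: "qfact v 0 = 1" "qfact v 1 = qint v 1" "qfact v (Suc 0) = qint v 1" "qfact v 2 = qint v 1 * qint v 2" 
    "qfact v 3 = qint v 1 * qint v 2 * qint v 3"
    by (simp_all add: qfact_def numeral_2_eq_2 numeral_3_eq_3)
  have "qint v 1 = 1" using d by (simp add: qint_def power_int_minus)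
  then show "qbinom v 3 0 = 1" "qbinom v 3 1 = v\<^sup>2 + 1 + inverse (v\<^sup>2)"
    "qbinom v 3 2 = v\<^sup>2 + 1 + inverse (v\<^sup>2)" "qbinom v 3 3 = 1"
    using nz[of 2] nz[of 3] by (simp_all add: qbinom_def f q3[symmetric])
qed

lemma insert_prod_const:
  "k \<le> r \<Longrightarrow> insert_prod r (\<lambda>_. x) y k = x ^ k * y * x ^ (r - k)"
  by (simp add: insert_prod_def map_replicate_const prod_list_replicate del: upt_Suc)

lemma insert_prod_cong:
  assumes "\<And>p. p \<in> {1..r} \<Longrightarrow> x p = x' p" and "k \<le> r"
  shows "insert_prod r x y k = insert_prod r x' y k"
proof -
  have "map x [1..<k + 1] = map x' [1..<k + 1]" "map x [k + 1..<r + 1] = map x' [k + 1..<r + 1]"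
    using assms by (auto simp del: upt_Suc)
  then show ?thesis by (simp only: insert_prod_def)
qed

text \<open>\<open>T9\<close> counts the factors to the left of the inserted one, the small algebra
  those to its right. Passing from one to the other only costs the sign \<open>(-1) ^ r\<close>, by
  symmetry of the binomials.\<close>

lemma alternating_qbinom_sum_rev:
  "(\<Sum>t\<le>r. ((-1) ^ t * qbinom v r t) *\<^sub>K f (r - t))
    = (-1) ^ r *\<^sub>K (\<Sum>t\<le>r. ((-1) ^ t * qbinom v r t) *\<^sub>K f t)"
proof -
  have "(\<Sum>t\<le>r. ((-1) ^ t * qbinom v r t) *\<^sub>K f (r - t))
      = (\<Sum>t\<le>r. ((-1) ^ (r - t) * qbinom v r (r - t)) *\<^sub>K f t)"
    by (rule sum.reindex_bij_witness[of _ "\<lambda>t. r - t" "\<lambda>t. r - t"]) auto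
  also have "\<dots> = (\<Sum>t\<le>r. (-1) ^ r *\<^sub>K ((-1) ^ t * qbinom v r t) *\<^sub>K f t)"
  proof (rule sum.cong)
    fix t assume "t \<in> {..r}"
    then have "(- 1) ^ (r - t) = (- 1 :: Cq) ^ r * (- 1) ^ t"
      by (metis (no_types, lifting) atMost_iff mult.right_neutral power_add power_mult_distrib
          mult_minus1_right minus_minus power_one le_add_diff_inverse2 mult.assoc)
    then show "((-1) ^ (r - t) * qbinom v r (r - t)) *\<^sub>K f t
        = (-1) ^ r *\<^sub>K ((-1) ^ t * qbinom v r t) *\<^sub>K f t"
      using \<open>t \<in> {..r}\<close> by (simp add: qbinom_symmetric mult.assoc)
  qed simp
  finally show ?thesis by (simp only: scal.scale_sum_right)
qed

text \<open>Splitting off the linear term makes it possible to solve for \<open>fps_nth Y m\<close>,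
  since the higher powers involve lower coefficients only.\<close>

lemma exp_series_nth:
  assumes "fps_nth Y 0 = 0" and "0 < m"
  shows "fps_nth (exp_series Y) m
    = fps_nth Y m + (\<Sum>k\<in>{2..m}. (1 / of_nat (fact k)) *\<^sub>K fps_nth (Y ^ k) m)"
proof -
  have "{..m} = insert 0 (insert 1 {2..m})" using assms by auto
  then show ?thesis using assms by (simp add: exp_series_def)
qed

context presentation
begin

lemma qcomm_cong:
  assumes "qcomm v f g - h \<in> R" "f \<in> FA G" "g \<in> FA G" "h \<in> FA G"
  shows "f * g \<approx> v *\<^sub>K (g * f) + h"
  using assms rels_in_L by (auto simp: cong_def qcomm_def algebra_simps)

text \<open>With \<open>l\<close> and \<open>r\<close> denoting left and right multiplication by \<open>X\<close>, the left-hand side is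
  \<open>(l - v\<^sup>2 r) (l - v r) (l - r) Y\<close>; each factor applied in turn gives a multiple of \<open>A\<close>, then a
  multiple of \<open>x'\<close>, then zero.\<close>

lemma cubic_relation:
  assumes XY: "X * Y - Y * X \<approx> u * (k * A)" and Xu: "X * u \<approx> u * X"
    and Xk: "X * k \<approx> v *\<^sub>K (k * X)" and AX: "A * X - X * A \<approx> w * x'"
    and Xw: "X * w \<approx> w * X" and Xx: "X * x' \<approx> v *\<^sub>K (x' * X)"
    and closed: "X \<in> FA G" "Y \<in> FA G" "u \<in> FA G" "k \<in> FA G" "A \<in> FA G" "w \<in> FA G" "x' \<in> FA G"
  shows "X ^ 3 * Y - (1 + v + v\<^sup>2) *\<^sub>K (X\<^sup>2 * Y * X) + (v + v\<^sup>2 + v ^ 3) *\<^sub>K (X * Y * X\<^sup>2)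
    - v ^ 3 *\<^sub>K (Y * X ^ 3) \<in> L"
proof -
  define D where "D = X * Y - Y * X"
  define E where "E = X * D - v *\<^sub>K (D * X)"
  define E' where "E' = - v *\<^sub>K (u * (k * (w * x')))"
  note cl = closed
  have Xuk: "X * (u * (k * f)) \<approx> v *\<^sub>K (u * (k * (X * f)))" if f: "f \<in> FA G" for f
  proof -
    have "(X * u) * (k * f) \<approx> (u * X) * (k * f)"
      using f cl by (intro cong_mult[OF Xu] cong_refl) simp_all
    moreover have "u * ((X * k) * f) \<approx> u * ((v *\<^sub>K (k * X)) * f)"
      using f cl by (intro cong_mult[OF cong_refl cong_mult[OF Xk]] cong_refl) simp_all
    ultimately show ?thesis
      using cong_trans by (simp add: mult.assoc scal_simps)
  qed
  have "X * D - v *\<^sub>K (D * X) \<approx> X * (u * (k * A)) - v *\<^sub>K ((u * (k * A)) * X)"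
    unfolding D_def using cl
    by (intro cong_diff cong_scal cong_mult[OF _ XY] cong_mult[OF XY] cong_refl) simp_all
  also have "\<dots> \<approx> v *\<^sub>K (u * (k * (X * A))) - v *\<^sub>K ((u * (k * A)) * X)"
    using cl by (intro cong_diff Xuk cong_refl) simp_all
  also have "v *\<^sub>K (u * (k * (X * A))) - v *\<^sub>K ((u * (k * A)) * X) = - v *\<^sub>K (u * (k * (A * X - X * A)))"
    by (simp add: algebra_simps scal_simps)
  also have "\<dots> \<approx> E'"
    unfolding E'_def using cl
    by (intro cong_scal cong_mult[OF cong_refl cong_mult[OF cong_refl AX]]) simp_all
  finally have EE': "E \<approx> E'" by (simp add: E_def)
  \<comment> \<open>Moving \<open>X\<close> through \<open>E'\<close> costs one \<open>v\<close> at
    \<open>k\<close> and another at \<open>x'\<close>, while \<open>u\<close> and \<open>w\<close>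
    let it pass; hence the twist \<open>v\<^sup>2\<close>.\<close>
  have "u * (k * ((X * w) * x')) \<approx> u * (k * ((w * X) * x'))"
    using cl by (intro cong_mult[OF cong_refl cong_mult[OF cong_refl cong_mult[OF Xw cong_refl]]]) simp_all
  also have "u * (k * ((w * X) * x')) = u * (k * (w * (X * x')))" by (simp add: mult.assoc)
  also have "\<dots> \<approx> u * (k * (w * (v *\<^sub>K (x' * X))))"
    using cl by (intro cong_mult[OF cong_refl cong_mult[OF cong_refl cong_mult[OF cong_refl Xx]]]) simp_all
  finally have "v *\<^sub>K (u * (k * ((X * w) * x'))) \<approx> v *\<^sub>K (u * (k * (w * (v *\<^sub>K (x' * X)))))"
    by (rule cong_scal)
  then have "X * (u * (k * (w * x'))) \<approx> v\<^sup>2 *\<^sub>K ((u * (k * (w * x'))) * X)"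
    using cong_trans[OF Xuk[of "w * x'"]] cl by (simp add: mult.assoc scal_simps power2_eq_square)
  then have "- v *\<^sub>K (X * (u * (k * (w * x')))) \<approx> - v *\<^sub>K (v\<^sup>2 *\<^sub>K ((u * (k * (w * x'))) * X))"
    by (rule cong_scal)
  then have "X * E' \<approx> v\<^sup>2 *\<^sub>K (E' * X)"
    by (simp add: E'_def scal_simps mult.commute)
  then have XE': "X * E' - v\<^sup>2 *\<^sub>K (E' * X) \<in> L" by (simp add: cong_def)
  have "X * E - v\<^sup>2 *\<^sub>K (E * X) \<approx> X * E' - v\<^sup>2 *\<^sub>K (E' * X)"
    using cl by (intro cong_diff cong_scal cong_mult[OF _ EE'] cong_mult[OF EE'] cong_refl) simp_all
  then have "X * E - v\<^sup>2 *\<^sub>K (E * X) \<in> L"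
    using XE' cong_trans cong_zero_iff by blast
  \<comment> \<open>The coefficients are the elementary symmetric functions of \<open>1\<close>,
    \<open>v\<close> and \<open>v\<^sup>2\<close>, because left and right multiplication by
    \<open>X\<close> commute.\<close>
  moreover have "X * E - v\<^sup>2 *\<^sub>K (E * X) = X ^ 3 * Y - (1 + v + v\<^sup>2) *\<^sub>K (X\<^sup>2 * Y * X)
      + (v + v\<^sup>2 + v ^ 3) *\<^sub>K (X * Y * X\<^sup>2) - v ^ 3 *\<^sub>K (Y * X ^ 3)"
    by (simp add: E_def D_def algebra_simps scal_simps power2_eq_square power3_eq_cube)
  ultimately show ?thesis by simp
qed

end

section \<open>The relations of the smaller algebra\<close>

lemma sg_opp [simp]: "sg (opp \<epsilon>) = - sg \<epsilon>" and opp_opp [simp]: "opp (opp \<epsilon>) = \<epsilon>"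
  by (cases \<epsilon>; simp)+

lemma sg_square [simp]: "sg \<epsilon> * sg \<epsilon> = 1" "sg \<epsilon> * (sg \<epsilon> * m) = m" "\<bar>sg \<epsilon>\<bar> = 1" "sg \<epsilon> \<noteq> 0"
  by (cases \<epsilon>; simp)+

lemma ax_zero [simp]: "ax 0 s = zero_vec"
  by (simp add: ax_def zero_vec_def fun_eq_iff)

lemma ax_add: "(\<lambda>r. ax k s r + ax l s r) = ax (k + l) s"
  by (simp add: ax_def fun_eq_iff)

context toroidal_data
begin

lemma Lat_ax [simp]: "s \<in> J \<Longrightarrow> ax k s \<in> Lat"
  by (auto simp: Lat_def ax_def)

lemma Lat_zero [simp]: "zero_vec \<in> Lat"
  by (simp add: Lat_def zero_vec_def)

lemma Lat_add: "k \<in> Lat \<Longrightarrow> l \<in> Lat \<Longrightarrow> (\<lambda>r. k r + l r) \<in> Lat"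
  by (simp add: Lat_def)

lemma tor_gens_simps [simp]:
  "GX \<epsilon> i k \<in> tor_gens \<longleftrightarrow> i \<in> I \<and> k \<in> Lat"
  "GA s i l \<in> tor_gens \<longleftrightarrow> s \<in> J \<and> i \<in> I \<and> l \<noteq> 0"
  "GK \<epsilon> i \<in> tor_gens \<longleftrightarrow> i \<in> I" "GC \<epsilon> s \<in> tor_gens \<longleftrightarrow> s \<in> J" "GD \<epsilon> \<in> tor_gens"
  by (auto simp: tor_gens_def)

lemma zero_in_I [simp]: "0 \<in> I"
  by (simp add: I_def)

lemma gens0_simps [simp]:
  "i \<in> I \<Longrightarrow> GX \<epsilon> i zero_vec \<in> gens0"
  "GK \<epsilon> i \<in> gens0 \<longleftrightarrow> i \<in> I" "GC \<epsilon> s \<in> gens0 \<longleftrightarrow> s \<in> J" "GD \<epsilon> \<in> gens0"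
  by (auto simp: gens0_def)

text \<open>\<open>gens0\<close> indexes these generators by the opposite sign; this is the form in
  which most relations and the generation argument name them.\<close>

lemma gens0_GX0: "s \<in> J \<Longrightarrow> k = - sg \<epsilon> \<Longrightarrow> GX \<epsilon> 0 (ax k s) \<in> gens0"
proof -
  assume "s \<in> J" "k = - sg \<epsilon>"
  then have "GX \<epsilon> 0 (ax k s) = GX (opp (opp \<epsilon>)) 0 (ax (sg (opp \<epsilon>)) s)" by simp
  then show ?thesis using \<open>s \<in> J\<close> unfolding gens0_def by blast
qed

lemma gens0_subset: "gens0 \<subseteq> tor_gens"
  by (auto simp: gens0_def tor_gens_def)

lemma gam_half_closed [simp]:
  assumes "GC Positive s \<in> G" "GC Negative s \<in> G" shows "gam_half s m \<in> FA G"
  using assms by (simp add: gam_half_def)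

lemma FA_fps_power:
  assumes "\<And>m. fps_nth Y m \<in> FA G" shows "fps_nth (Y ^ k) m \<in> FA G"
  using assms by (induction k arbitrary: m) (auto simp: fps_mult_nth intro!: FA_sum)

lemma FA_exp_series:
  assumes "\<And>m. fps_nth Y m \<in> FA G" shows "fps_nth (exp_series Y) m \<in> FA G"
  unfolding exp_series_def using FA_fps_power[OF assms] by (simp add: FA_sum)

lemma phi_closed [simp]:
  assumes "s \<in> J" "i \<in> I" shows "phi s i m \<in> FA tor_gens" "varphi s i m \<in> FA tor_gens"
  using assms by (auto simp: phi_def varphi_def intro!: FA_mult FA_exp_series)

lemma tor_rels_closed: "tor_rels \<subseteq> FA tor_gens"
proof
  fix f assume "f \<in> tor_rels"
  then show "f \<in> FA tor_gens"
    by (cases rule: tor_rels.cases) (auto simp: Lat_add intro!: FA_sum FA_insert_prod FA_scal)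
qed

lemma rels0_closed: "rels0 \<subseteq> FA gens0"
proof
  fix f assume "f \<in> rels0"
  then show "f \<in> FA gens0"
  proof (cases rule: rels0.cases)
    case (R10 s j r m \<epsilon>)
    have "x\<^sub>g \<epsilon> 0 (m (\<sigma> p)) \<in> FA gens0" if "\<sigma> permutes {1..r}" "p \<in> {1..r}" for \<sigma> p
    proof -
      have "m (\<sigma> p) \<in> {zero_vec, ax (- sg \<epsilon>) s}"
        using R10 that permutes_in_image[OF that(1)] by blast
      then show ?thesis using R10 by (auto simp: gens0_GX0)
    qed
    then show ?thesis using R10 by (auto intro!: FA_sum FA_scal FA_insert_prod)
  qed (simp_all add: FA_sum gens0_GX0)
qed

end

section \<open>Commutation rules in the toroidal algebra\<close>

context toroidal_data
begin

sublocale T: presentation tor_gens tor_rels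
  by unfold_locales (rule tor_rels_closed)

notation T.cong (infix "\<sim>" 50)

abbreviation "L_tor \<equiv> T.L"

text \<open>\<open>T1\<close> gives commutation with generators only; the elements commuting with
  \<open>\<gamma>\<close> modulo the relations are closed under sums and products.\<close>

lemma c_central:
  assumes "s \<in> J" "f \<in> FA tor_gens" shows "f * c\<^sub>g \<epsilon> s \<sim> c\<^sub>g \<epsilon> s * f"
proof -
  have c: "c\<^sub>g \<epsilon> s \<in> FA tor_gens" using assms by simp
  show ?thesis using assms(2)
  proof (induction f rule: FA_induct)
    case (scal_one k)
    then show ?case using c by (simp add: scal_simps)
  next
    case (gen g)
    have "c\<^sub>g \<epsilon> s * gen g \<sim> gen g * c\<^sub>g \<epsilon> s"
      using T.qcomm_cong[of 1 "c\<^sub>g \<epsilon> s" "gen g" 0] tor_rels.T1_central[of s g \<epsilon>] assms(1) gen by simp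
    then show ?case by (rule T.cong_sym)
  next
    case (add f g)
    then show ?case using T.cong_add by (simp add: distrib_left distrib_right)
  next
    case (mult f g)
    note f = mult(1,2)
    have "f * (g * c\<^sub>g \<epsilon> s) \<sim> f * (c\<^sub>g \<epsilon> s * g)" by (intro T.cong_mult[OF T.cong_refl mult(4)] f)
    also have "f * (c\<^sub>g \<epsilon> s * g) = (f * c\<^sub>g \<epsilon> s) * g" by (simp add: mult.assoc)
    also have "\<dots> \<sim> (c\<^sub>g \<epsilon> s * f) * g" by (intro T.cong_mult[OF mult(3)] T.cong_refl f)
    finally show ?case by (simp add: mult.assoc)
  qed
qed

lemma power_central:
  assumes "z \<in> FA tor_gens" "\<And>f. f \<in> FA tor_gens \<Longrightarrow> f * z \<sim> z * f" "f \<in> FA tor_gens"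
  shows "f * z ^ k \<sim> z ^ k * f"
proof (induction k)
  case (Suc k)
  have "(f * z) * z ^ k \<sim> (z * f) * z ^ k"
    using assms by (intro T.cong_mult[OF _ T.cong_refl]) simp_all
  also have "(z * f) * z ^ k = z * (f * z ^ k)" by (simp add: mult.assoc)
  also have "\<dots> \<sim> z * (z ^ k * f)" using assms by (intro T.cong_mult[OF T.cong_refl Suc])
  finally show ?case by (simp add: mult.assoc)
qed (use assms in simp)

lemma gam_half_central: "s \<in> J \<Longrightarrow> f \<in> FA tor_gens \<Longrightarrow> f * gam_half s m \<sim> gam_half s m * f"
  by (simp add: gam_half_def power_central c_central)

lemma c_inv: "s \<in> J \<Longrightarrow> c\<^sub>g \<epsilon> s * c\<^sub>g (opp \<epsilon>) s \<sim> 1"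
proof -
  assume s: "s \<in> J"
  then have 1: "c\<^sub>g Positive s * c\<^sub>g Negative s \<sim> 1"
    by (intro T.cong_relation tor_rels.T1_gamma) simp_all
  then have "c\<^sub>g Negative s * c\<^sub>g Positive s \<sim> 1"
    using T.cong_trans[OF c_central[OF s]] s by simp
  then show ?thesis using 1 by (cases \<epsilon>) simp_all
qed

lemma c_power_inv: "s \<in> J \<Longrightarrow> c\<^sub>g \<epsilon> s ^ k * c\<^sub>g (opp \<epsilon>) s ^ k \<sim> 1"
proof (induction k)
  case (Suc k)
  then have IH: "c\<^sub>g \<epsilon> s ^ k * c\<^sub>g (opp \<epsilon>) s ^ k \<sim> 1" and s: "s \<in> J" by simp_all
  have "c\<^sub>g \<epsilon> s ^ k * ((c\<^sub>g \<epsilon> s * c\<^sub>g (opp \<epsilon>) s) * c\<^sub>g (opp \<epsilon>) s ^ k)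
      \<sim> c\<^sub>g \<epsilon> s ^ k * (1 * c\<^sub>g (opp \<epsilon>) s ^ k)"
    using s by (intro T.cong_mult[OF T.cong_refl T.cong_mult[OF c_inv]] T.cong_refl) simp_all
  also have "c\<^sub>g \<epsilon> s ^ k * (1 * c\<^sub>g (opp \<epsilon>) s ^ k) = c\<^sub>g \<epsilon> s ^ k * c\<^sub>g (opp \<epsilon>) s ^ k" by simp
  also have "\<dots> \<sim> 1" by (rule IH)
  finally show ?case
    unfolding power_Suc2[of "c\<^sub>g \<epsilon> s"] power_Suc[of "c\<^sub>g (opp \<epsilon>) s"] by (simp add: mult.assoc)
qed simp

lemma gam_half_inv: "s \<in> J \<Longrightarrow> gam_half s (- m) * gam_half s m \<sim> 1"
  using c_power_inv[of s Positive "nat (- m)"] c_power_inv[of s Negative "nat m"]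
  by (cases "m = 0") (simp_all add: gam_half_def)

lemma K_inv: "i \<in> I \<Longrightarrow> K\<^sub>g \<epsilon> i * K\<^sub>g (opp \<epsilon>) i \<sim> 1"
  by (intro T.cong_relation tor_rels.T1_K_inv) simp_all

text \<open>Multiplying the conjugation relation \<open>T4\<close> by the appropriate inverse turns
  it into a rule for moving \<open>x\<close> past \<open>K\<close>, for both signs of
  \<open>K\<close> at once.\<close>

lemma x_K:
  assumes "i \<in> I" "j \<in> I" "k \<in> Lat" "d i \<noteq> 0"
  shows "x\<^sub>g \<epsilon> j k * K\<^sub>g \<tau> i \<sim> (qq i powi (- sg \<epsilon> * sg \<tau> * a i j)) *\<^sub>K (K\<^sub>g \<tau> i * x\<^sub>g \<epsilon> j k)"
proof -
  let ?x = "x\<^sub>g \<epsilon> j k" and ?P = "K\<^sub>g Positive i" and ?N = "K\<^sub>g Negative i"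
  let ?c = "qq i powi (sg \<epsilon> * a i j)"
  have c: "?c \<noteq> 0" using q_nonzero by (simp add: qq_def)
  have [simp]: "?x \<in> FA tor_gens" "?P \<in> FA tor_gens" "?N \<in> FA tor_gens" using assms by simp_all
  have PN: "?P * ?N \<sim> 1" "?N * ?P \<sim> 1"
    using K_inv[OF assms(1), of Positive] K_inv[OF assms(1), of Negative] by simp_all
  have main: "?P * ?x * ?N \<sim> ?c *\<^sub>K ?x"
    using assms by (intro T.cong_relation tor_rels.T4_K) simp_all
  show ?thesis
  proof (cases \<tau>)
    case Positive
    have "(?P * ?x) * 1 \<sim> (?P * ?x) * (?N * ?P)"
      by (intro T.cong_mult[OF T.cong_refl T.cong_sym[OF PN(2)]]) simp_all
    also have "(?P * ?x) * (?N * ?P) = (?P * ?x * ?N) * ?P" by (simp add: mult.assoc)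
    also have "\<dots> \<sim> (?c *\<^sub>K ?x) * ?P" by (intro T.cong_mult[OF main T.cong_refl]) simp_all
    finally have "inverse ?c *\<^sub>K (?P * ?x * 1) \<sim> inverse ?c *\<^sub>K ((?c *\<^sub>K ?x) * ?P)"
      by (rule T.cong_scal)
    then show ?thesis
      using T.cong_sym c Positive by (simp add: scal_simps power_int_minus)
  next
    case Negative
    have "1 * (?x * ?N) \<sim> (?N * ?P) * (?x * ?N)"
      by (intro T.cong_mult[OF T.cong_sym[OF PN(2)] T.cong_refl]) simp_all
    also have "(?N * ?P) * (?x * ?N) = ?N * (?P * ?x * ?N)" by (simp add: mult.assoc)
    also have "\<dots> \<sim> ?N * (?c *\<^sub>K ?x)" by (intro T.cong_mult[OF T.cong_refl main]) simp_all
    finally show ?thesis using Negative by (simp add: scal_simps)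
  qed
qed

text \<open>In positive degree this is \<open>phi\<close> or \<open>varphi\<close>, according to the
  sign \<open>\<tau>\<close>, without its factor \<open>K\<close>; one formula then serves both
  halves of \<open>T8\<close>.\<close>

definition exp_coeff :: "sign \<Rightarrow> nat \<Rightarrow> nat \<Rightarrow> nat \<Rightarrow> tor_free" where
  "exp_coeff \<tau> s i m = fps_nth (exp_series (Abs_fps (\<lambda>l. if l = 0 then 0
     else (of_int (sg \<tau>) * (qq i - inverse (qq i))) *\<^sub>K a\<^sub>g s i (sg \<tau> * int l)))) m"

lemma exp_coeff_closed [simp]: "s \<in> J \<Longrightarrow> i \<in> I \<Longrightarrow> exp_coeff \<tau> s i m \<in> FA tor_gens"
  unfolding exp_coeff_def by (rule FA_exp_series) simp

text \<open>In non-zero total degree only one of \<open>phi\<close> and \<open>varphi\<close>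
  survives, and \<open>\<tau>\<close> tells which; the scalar \<open>sg \<tau>\<close> is the sign
  in front of it in \<open>T8\<close>.\<close>

lemma commutator_plus_minus:
  assumes "s \<in> J" "i \<in> I" "0 < m" "t + t' = sg \<tau> * int m"
  shows "x\<^sub>g Positive i (ax t s) * x\<^sub>g Negative i (ax t' s) - x\<^sub>g Negative i (ax t' s) * x\<^sub>g Positive i (ax t s)
    \<sim> (of_int (sg \<tau>) / (qq i - inverse (qq i))) *\<^sub>K
        (gam_half s (sg \<tau> * (t - t')) * (K\<^sub>g \<tau> i * exp_coeff \<tau> s i m))"
proof (rule T.cong_relation)
  have *: "nat (int m) = m" "\<not> int m < 0" "\<not> 0 < - int m" using assms(3) by auto
  show "x\<^sub>g Positive i (ax t s) * x\<^sub>g Negative i (ax t' s) - x\<^sub>g Negative i (ax t' s) * x\<^sub>g Positive i (ax t s)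
      - (of_int (sg \<tau>) / (qq i - inverse (qq i))) *\<^sub>K
        (gam_half s (sg \<tau> * (t - t')) * (K\<^sub>g \<tau> i * exp_coeff \<tau> s i m)) \<in> tor_rels"
    using tor_rels.T8[OF assms(1,2,2), of t t'] assms(3,4)
    by (cases \<tau>) (simp_all add: qcomm_def phi_def varphi_def exp_coeff_def cong: if_cong)
qed (use assms in simp_all)

lemma exp_coeff_one: "exp_coeff \<tau> s i 1
    = (of_int (sg \<tau>) * (qq i - inverse (qq i))) *\<^sub>K a\<^sub>g s i (sg \<tau>)"
  unfolding exp_coeff_def by (subst exp_series_nth) simp_all

text \<open>In degree one the factor \<open>qq i - inverse (qq i)\<close> of the linear term cancels
  the denominator of \<open>T8\<close>. What is left is \<open>K\<close> times \<open>a\<close>, up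
  to a power of \<open>\<gamma>\<close> with a sign when the order is reversed; of this only
  centrality is kept, as the cubic argument asks for no more.\<close>

lemma commutator_one:
  assumes "s \<in> J" "i \<in> I" "p + p' = sg \<tau>" "qq i - inverse (qq i) \<noteq> 0"
  shows "\<exists>u. u \<in> FA tor_gens \<and> (\<forall>f\<in>FA tor_gens. f * u \<sim> u * f) \<and>
    x\<^sub>g \<epsilon> i (ax p s) * x\<^sub>g (opp \<epsilon>) i (ax p' s) - x\<^sub>g (opp \<epsilon>) i (ax p' s) * x\<^sub>g \<epsilon> i (ax p s)
    \<sim> u * (K\<^sub>g \<tau> i * a\<^sub>g s i (sg \<tau>))"
proof (cases \<epsilon>)
  case Positive
  then show ?thesis
    using commutator_plus_minus[OF assms(1,2), of 1 p p' \<tau>] assms gam_half_central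
    by (intro exI[of _ "gam_half s (sg \<tau> * (p - p'))"])
      (simp add: exp_coeff_one[unfolded One_nat_def] scal_simps flip: of_int_mult)
next
  case Negative
  have "x\<^sub>g Positive i (ax p' s) * x\<^sub>g Negative i (ax p s) - x\<^sub>g Negative i (ax p s) * x\<^sub>g Positive i (ax p' s)
    \<sim> gam_half s (sg \<tau> * (p' - p)) * (K\<^sub>g \<tau> i * a\<^sub>g s i (sg \<tau>))"
    using commutator_plus_minus[OF assms(1,2), of 1 p' p \<tau>] assms
    by (simp add: exp_coeff_one[unfolded One_nat_def] scal_simps add.commute flip: of_int_mult)
  from T.cong_scal[OF this, of "- 1"] show ?thesis
    using assms gam_half_central[THEN T.cong_scal[of _ _ "- 1"]] Negative
    by (intro exI[of _ "- gam_half s (sg \<tau> * (p' - p))"]) simp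
qed

lemma a_x_commutator:
  assumes "s \<in> J" "i \<in> I" "j \<in> I" "l \<noteq> 0" "k \<in> Lat"
  shows "a\<^sub>g s i l * x\<^sub>g \<epsilon> j k - x\<^sub>g \<epsilon> j k * a\<^sub>g s i l \<sim> (of_int (sg \<epsilon>) * acoef i j l) *\<^sub>K
    (gam_half s (- sg \<epsilon> * \<bar>l\<bar>) * x\<^sub>g \<epsilon> j (\<lambda>r. k r + ax l s r))"
proof (rule T.cong_relation)
  show "a\<^sub>g s i l * x\<^sub>g \<epsilon> j k - x\<^sub>g \<epsilon> j k * a\<^sub>g s i l - (of_int (sg \<epsilon>) * acoef i j l) *\<^sub>K
    (gam_half s (- sg \<epsilon> * \<bar>l\<bar>) * x\<^sub>g \<epsilon> j (\<lambda>r. k r + ax l s r)) \<in> tor_rels"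
    using tor_rels.T5[OF assms, of \<epsilon>] by (simp add: qcomm_def)
qed (use assms in \<open>simp_all add: Lat_add\<close>)

end

text \<open>This isolates what the algebra part takes from the Lie algebra: the diagonal entries,
  and connectedness in the form of an induction principle starting at the affine node.\<close>

locale toroidal_affine = toroidal_data +
  assumes d_pos: "i \<in> I \<Longrightarrow> 0 < d i" and N_gt_2: "N > 2"
    and diagonal: "i \<in> I \<Longrightarrow> a i i = 2"
    and connected: "0 \<in> S \<Longrightarrow> (\<And>i j. i \<in> S \<inter> I \<Longrightarrow> j \<in> I \<Longrightarrow> a i j \<noteq> 0 \<Longrightarrow> j \<in> S) \<Longrightarrow> I \<subseteq> S"
begin

lemma one_in_J: "1 \<in> J"
  using N_gt_2 by (simp add: J_def)

lemma qq_difference: "i \<in> I \<Longrightarrow> qq i - inverse (qq i) \<noteq> 0"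
  using generic_difference_nonzero[of "d i" 1] d_pos by (simp add: qq_def power_int_minus)

lemma acoef_nonzero: "i \<in> I \<Longrightarrow> a i j \<noteq> 0 \<Longrightarrow> l \<noteq> 0 \<Longrightarrow> acoef i j l \<noteq> 0"
  using d_pos of_int_Cq_nonzero[of l] by (simp add: acoef_def qq_def qint_nonzero)

text \<open>For \<open>i = j\<close> and \<open>t = t'\<close> the two terms of \<open>T7\<close>
  coincide, so twice the twisted commutator vanishes. This moves \<open>x\<close> past its upper
  neighbour; dividing by the twist treats the other direction.\<close>

lemma x_x_same_node:
  assumes "s \<in> J" "i \<in> I"
  shows "x\<^sub>g \<epsilon> i (ax p s) * x\<^sub>g \<epsilon> i (ax (p + sg \<tau>) s)
    \<sim> (qq i powi (- 2 * sg \<epsilon> * sg \<tau>)) *\<^sub>K (x\<^sub>g \<epsilon> i (ax (p + sg \<tau>) s) * x\<^sub>g \<epsilon> i (ax p s))"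
proof -
  have up: "x\<^sub>g \<epsilon> i (ax (t + 1) s) * x\<^sub>g \<epsilon> i (ax t s)
      \<sim> (qq i powi (2 * sg \<epsilon>)) *\<^sub>K (x\<^sub>g \<epsilon> i (ax t s) * x\<^sub>g \<epsilon> i (ax (t + 1) s))" for t
  proof -
    let ?C = "qcomm (qq i powi (2 * sg \<epsilon>)) (x\<^sub>g \<epsilon> i (ax (t + 1) s)) (x\<^sub>g \<epsilon> i (ax t s))"
    have "?C + ?C \<in> L_tor"
      using tor_rels.T7[OF assms(1,2,2), of \<epsilon> t t] T.rels_in_L diagonal[OF assms(2)]
      by (auto simp: mult.commute)
    moreover have "?C + ?C = 2 *\<^sub>K ?C"
      by (metis one_add_one scal.scale_left_distrib scal.scale_one)
    moreover have "(2 :: Cq) \<noteq> 0" using of_nat_Cq_nonzero[of 2] by simp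
    ultimately have "?C \<in> L_tor" using T.L_scal_iff by metis
    then show ?thesis using assms by (simp add: T.cong_def qcomm_def)
  qed
  have q0: "qq i \<noteq> 0" using q_nonzero by (simp add: qq_def)
  show ?thesis
  proof (cases \<tau>)
    case Positive
    have "(qq i powi (- 2 * sg \<epsilon>)) *\<^sub>K (x\<^sub>g \<epsilon> i (ax (p + 1) s) * x\<^sub>g \<epsilon> i (ax p s))
        \<sim> x\<^sub>g \<epsilon> i (ax p s) * x\<^sub>g \<epsilon> i (ax (p + 1) s)"
      using T.cong_scal[OF up[of p], of "qq i powi (- 2 * sg \<epsilon>)"] q0
      by (simp flip: power_int_add)
    then show ?thesis using T.cong_sym Positive by simp
  next
    case Negative
    then show ?thesis using up[of "p - 1"] by simp
  qed
qed

text \<open>Here \<open>A\<close> is \<open>a\<close> of degree \<open>sg \<tau>\<close> and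
  \<open>x'\<close> is the neighbour of \<open>X\<close> in direction \<open>\<tau>\<close>. As the
  diagonal Cartan entry is 2, the \<open>v\<close> from \<open>K\<close> and the \<open>v\<close>
  from \<open>x'\<close> agree, as \<open>cubic_relation\<close> requires.\<close>

lemma cubic_serre:
  fixes \<epsilon> \<tau> :: sign and p p' :: int
  assumes "s \<in> J" "i \<in> I" "p + p' = sg \<tau>"
  defines "X \<equiv> x\<^sub>g \<epsilon> i (ax p s)" and "Y \<equiv> x\<^sub>g (opp \<epsilon>) i (ax p' s)"
    and "v \<equiv> qq i powi (- 2 * sg \<epsilon> * sg \<tau>)"
  shows "(\<Sum>t\<le>3. ((-1) ^ t * v ^ t * qbinom (qq i) 3 t) *\<^sub>K (X ^ (3 - t) * Y * X ^ t)) \<in> L_tor"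
proof -
  obtain u where u: "u \<in> FA tor_gens" "\<forall>f\<in>FA tor_gens. f * u \<sim> u * f"
    "X * Y - Y * X \<sim> u * (K\<^sub>g \<tau> i * a\<^sub>g s i (sg \<tau>))"
    using commutator_one[OF assms(1-3), of \<epsilon>] qq_difference[OF assms(2)] unfolding X_def Y_def by blast
  define c where "c = of_int (sg \<epsilon>) * acoef i i (sg \<tau>)"
  define w where "w = c *\<^sub>K gam_half s (- sg \<epsilon>)"
  define x' where "x' = x\<^sub>g \<epsilon> i (ax (p + sg \<tau>) s)"
  have closed: "X \<in> FA tor_gens" "Y \<in> FA tor_gens" "w \<in> FA tor_gens" "x' \<in> FA tor_gens"
    "K\<^sub>g \<tau> i \<in> FA tor_gens" "a\<^sub>g s i (sg \<tau>) \<in> FA tor_gens"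
    using assms(1,2) by (simp_all add: X_def Y_def w_def x'_def)
  have "X ^ 3 * Y - (1 + v + v\<^sup>2) *\<^sub>K (X\<^sup>2 * Y * X) + (v + v\<^sup>2 + v ^ 3) *\<^sub>K (X * Y * X\<^sup>2)
      - v ^ 3 *\<^sub>K (Y * X ^ 3) \<in> L_tor"
  proof (rule T.cubic_relation[OF u(3)])
    show "X * u \<sim> u * X" using u closed by blast
    show "X * K\<^sub>g \<tau> i \<sim> v *\<^sub>K (K\<^sub>g \<tau> i * X)"
      using x_K[of i i "ax p s" \<epsilon> \<tau>] assms(1,2) d_pos[OF assms(2)] diagonal[OF assms(2)]
      by (simp add: X_def v_def mult.commute mult.left_commute)
    show "a\<^sub>g s i (sg \<tau>) * X - X * a\<^sub>g s i (sg \<tau>) \<sim> w * x'"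
      using a_x_commutator[of s i i "sg \<tau>" "ax p s" \<epsilon>] assms(1,2)
      by (simp add: X_def w_def x'_def c_def ax_add scal_simps)
    show "X * w \<sim> w * X"
      using T.cong_scal[OF gam_half_central[OF assms(1) closed(1)]] by (simp add: w_def scal_simps)
    show "X * x' \<sim> v *\<^sub>K (x' * X)"
      using x_x_same_node[OF assms(1,2)] by (simp add: X_def x'_def v_def)
  qed (use closed u in simp_all)
  moreover have "(\<Sum>t\<le>3. ((-1) ^ t * v ^ t * qbinom (qq i) 3 t) *\<^sub>K (X ^ (3 - t) * Y * X ^ t))
      = X ^ 3 * Y - (1 + v + v\<^sup>2) *\<^sub>K (X\<^sup>2 * Y * X) + (v + v\<^sup>2 + v ^ 3) *\<^sub>K (X * Y * X\<^sup>2)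
      - v ^ 3 *\<^sub>K (Y * X ^ 3)"
  proof -
    have q0: "qq i \<noteq> 0" using q_nonzero by (simp add: qq_def)
    \<comment> \<open>\<open>v\<close> is the square of \<open>qq i\<close> or its inverse, and the
      quantum integer 3 is symmetric under inversion; so it equals \<open>v + 1 + inverse v\<close>
      in both cases.\<close>
    have v: "v = (qq i)\<^sup>2 \<and> inverse v = inverse ((qq i)\<^sup>2) \<or> v = inverse ((qq i)\<^sup>2) \<and> inverse v = (qq i)\<^sup>2"
      unfolding v_def by (cases \<epsilon>; cases \<tau>) (simp_all add: power_int_minus)
    have v0: "v \<noteq> 0" using v q0 by auto
    define b where "b = v + 1 + inverse v"
    have b: "(qq i)\<^sup>2 + 1 + inverse ((qq i)\<^sup>2) = b" using v by (auto simp: b_def)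
    have vb: "v * b = 1 + v + v\<^sup>2" "v\<^sup>2 * b = v + v\<^sup>2 + v ^ 3"
      using v0 by (simp_all add: b_def field_simps power2_eq_square power3_eq_cube)
    have sum3: "(\<Sum>t\<le>3. f t) = f 0 + f 1 + f 2 + f 3" for f :: "nat \<Rightarrow> tor_free"
      by (simp add: numeral_3_eq_3 numeral_2_eq_2)
    show ?thesis
      unfolding sum3 qbinom_three[OF d_pos[OF assms(2)] qq_def, unfolded b]
      by (simp add: vb flip: scal.scale_minus_left)
  qed
  ultimately show ?thesis by simp
qed

lemma serre_symmetrized:
  assumes "s \<in> J" "i \<in> I" "j \<in> I" "i \<noteq> j" "r = nat (1 - a i j)"
  shows "(\<Sum>\<sigma> | \<sigma> permutes {1..r}. \<Sum>t\<le>r. ((-1) ^ t * qbinom (qq i) r t) *\<^sub>K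
     insert_prod r (\<lambda>p. x\<^sub>g \<epsilon> i (ax (m (\<sigma> p)) s)) (x\<^sub>g \<epsilon> j (ax l s)) (r - t)) \<in> L_tor"
proof -
  let ?F = "\<lambda>\<sigma>. insert_prod r (\<lambda>p. x\<^sub>g \<epsilon> i (ax (m (\<sigma> p)) s)) (x\<^sub>g \<epsilon> j (ax l s))"
  have "(\<Sum>\<sigma> | \<sigma> permutes {1..r}. \<Sum>k\<le>r. ((-1) ^ k * qbinom (qq i) r k) *\<^sub>K ?F \<sigma> k) \<in> L_tor"
    using tor_rels.T9[OF assms, of \<epsilon> m l] T.rels_in_L by blast
  from T.L_scal[OF this, of "(-1) ^ r"] show ?thesis
    by (simp only: alternating_qbinom_sum_rev scal.scale_sum_right)
qed

text \<open>With all degrees equal, every permutation contributes the same summand, and the factor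
  \<open>fact r\<close> can be divided out.\<close>

lemma serre:
  assumes "s \<in> J" "i \<in> I" "j \<in> I" "i \<noteq> j" "r = nat (1 - a i j)"
  shows "(\<Sum>t\<le>r. ((-1) ^ t * qbinom (qq i) r t) *\<^sub>K
     (x\<^sub>g \<epsilon> i (ax m s) ^ (r - t) * x\<^sub>g \<epsilon> j (ax l s) * x\<^sub>g \<epsilon> i (ax m s) ^ t)) \<in> L_tor"
proof -
  let ?S = "\<Sum>t\<le>r. ((-1) ^ t * qbinom (qq i) r t) *\<^sub>K
     (x\<^sub>g \<epsilon> i (ax m s) ^ (r - t) * x\<^sub>g \<epsilon> j (ax l s) * x\<^sub>g \<epsilon> i (ax m s) ^ t)"
  have "(\<Sum>\<sigma> | \<sigma> permutes {1..r}. \<Sum>t\<le>r. ((-1) ^ t * qbinom (qq i) r t) *\<^sub>K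
     insert_prod r (\<lambda>p. x\<^sub>g \<epsilon> i (ax m s)) (x\<^sub>g \<epsilon> j (ax l s)) (r - t)) \<in> L_tor"
    using serre_symmetrized[OF assms, of \<epsilon> "\<lambda>_. m" l] .
  also have "(\<Sum>\<sigma> | \<sigma> permutes {1..r}. \<Sum>t\<le>r. ((-1) ^ t * qbinom (qq i) r t) *\<^sub>K
     insert_prod r (\<lambda>p. x\<^sub>g \<epsilon> i (ax m s)) (x\<^sub>g \<epsilon> j (ax l s)) (r - t)) = (\<Sum>\<sigma> | \<sigma> permutes {1..r}. ?S)"
    by (intro sum.cong refl) (simp add: insert_prod_const)
  also have "\<dots> = (\<Sum>\<sigma> | \<sigma> permutes {1..r}. 1 *\<^sub>K ?S)" by simp
  also have "\<dots> = of_nat (fact r) *\<^sub>K ?S"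
    unfolding scal.scale_sum_left[symmetric] by (simp add: card_permutations del: One_nat_def)
  finally show ?thesis
    using T.L_scal_iff of_nat_Cq_nonzero[of "fact r"] by simp
qed

lemma rels0_subset: "rels0 \<subseteq> L_tor"
proof
  fix f assume "f \<in> rels0"
  have tor: "f \<in> L_tor" if "f \<in> tor_rels" for f using that T.rels_in_L by blast
  \<comment> \<open>\<open>R4\<close> and \<open>R7\<close> mention no axis; they are read off axis
    1, on which \<open>zero_vec\<close> is \<open>ax 0 1\<close>.\<close>
  note J1 = one_in_J
  have powi_power: "(qq 0 powi m) ^ t = qq 0 powi (m * int t)" for m t
    by (simp add: power_int_mult)
  from \<open>f \<in> rels0\<close> show "f \<in> L_tor"
  proof (cases rule: rels0.cases)
    case (R1_central s g \<epsilon>)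
    then show ?thesis using tor[OF tor_rels.T1_central] gens0_subset by blast
  next
    case (R1_gamma s)
    then show ?thesis using tor[OF tor_rels.T1_gamma] by simp
  next
    case (R1_K_comm i j \<epsilon> \<epsilon>')
    then show ?thesis using tor[OF tor_rels.T1_K_comm] by simp
  next
    case (R1_d_K i \<epsilon> \<epsilon>')
    then show ?thesis
      using T.L_uminus[OF tor[OF tor_rels.T2_K_d[of i \<epsilon>' \<epsilon>]]] by (simp add: qcomm_def)
  next
    case (R1_K_inv i \<epsilon>)
    then show ?thesis using tor[OF tor_rels.T1_K_inv] by simp
  next
    case (R1_d_inv \<epsilon>)
    then show ?thesis using tor[OF tor_rels.T1_d_inv] by simp
  next
    case (R2 i j \<epsilon>)
    then show ?thesis using tor[OF tor_rels.T4_K] by simp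
  next
    case (R2_0 i s \<epsilon>)
    then show ?thesis using tor[OF tor_rels.T4_K[of i 0 "ax (sg \<epsilon>) s" "opp \<epsilon>"]] by simp
  next
    case (R3 i s \<epsilon>)
    show ?thesis
    proof (cases \<epsilon>)
      case Positive
      then show ?thesis
        using tor[OF tor_rels.T8[of s i 0 0 1]] R3 by (simp cong: if_cong)
    next
      case Negative
      then show ?thesis
        using T.L_uminus[OF tor[OF tor_rels.T8[of s 0 i "-1" 0]]] R3
        by (simp add: qcomm_def cong: if_cong)
    qed
  next
    case (R4 i j)
    have "phi 1 j 0 = K\<^sub>g Positive j" "varphi 1 j 0 = K\<^sub>g Negative j"
      by (simp_all add: phi_def varphi_def exp_series_def)
    then show ?thesis
      using tor[OF tor_rels.T8[of 1 i j 0 0]] R4 J1 by (cases "i = j") (simp_all add: gam_half_def)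
  next
    case (R4_0 s)
    have "phi s 0 0 = K\<^sub>g Positive 0" "varphi s 0 0 = K\<^sub>g Negative 0"
      by (simp_all add: phi_def varphi_def exp_series_def)
    then show ?thesis
      using tor[OF tor_rels.T8[of s 0 0 "-1" 1]] R4_0 by simp
  next
    case (R5 i \<epsilon>)
    then show ?thesis using tor[OF tor_rels.T4_d] by simp
  next
    case (R5_0 s \<epsilon>)
    then show ?thesis using tor[OF tor_rels.T4_d[of 0 "ax (sg \<epsilon>) s" "opp \<epsilon>"]] by simp
  next
    case (R6_0 s \<epsilon>)
    then show ?thesis
      using x_x_same_node[of s 0 "opp \<epsilon>" "sg \<epsilon>" "opp \<epsilon>"]
      by (cases \<epsilon>) (simp_all add: T.cong_def qcomm_def)
  next
    case (R6 s s' \<epsilon>)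
    then show ?thesis using tor[OF tor_rels.T6] by simp
  next
    case (R7 i j r \<epsilon>)
    then show ?thesis using serre[of 1 i j r \<epsilon> 0 0] J1 by simp
  next
    case (R8 s j r \<epsilon>)
    then show ?thesis using serre[of s j 0 r \<epsilon> 0 "- sg \<epsilon>"] by simp
  next
    case (R9 s j r \<epsilon>)
    then show ?thesis using serre[of s 0 j r \<epsilon> "- sg \<epsilon>" 0] by simp
  next
    case (R10 s j r m \<epsilon>)
    \<comment> \<open>\<open>T9\<close> expects integer degrees along the axis, whereas
      \<open>R10\<close> is given vectors. Values outside \<open>{1..r}\<close> do not matter, since
      permutations preserve this set.\<close>
    define m' where "m' = (\<lambda>p. if m p = zero_vec then 0 else - sg \<epsilon>)"
    have m': "m p = ax (m' p) s" if "p \<in> {1..r}" for p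
      using R10(6) that by (auto simp: m'_def)
    have "f = (\<Sum>\<sigma> | \<sigma> permutes {1..r}. \<Sum>t\<le>r. ((-1) ^ t * qbinom (qq 0) r t) *\<^sub>K
        insert_prod r (\<lambda>p. x\<^sub>g \<epsilon> 0 (ax (m' (\<sigma> p)) s)) (x\<^sub>g \<epsilon> j (ax 0 s)) (r - t))"
      unfolding R10(1)
    proof (intro sum.cong refl arg_cong[of _ _ "scal _"])
      fix \<sigma> t assume "\<sigma> \<in> {\<sigma>. \<sigma> permutes {1..r}}"
      then have "\<sigma> p \<in> {1..r}" if "p \<in> {1..r}" for p
        using that permutes_in_image[of \<sigma> "{1..r}" p] by blast
      then show "insert_prod r (\<lambda>p. x\<^sub>g \<epsilon> 0 (m (\<sigma> p))) (x\<^sub>g \<epsilon> j zero_vec) (r - t)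
          = insert_prod r (\<lambda>p. x\<^sub>g \<epsilon> 0 (ax (m' (\<sigma> p)) s)) (x\<^sub>g \<epsilon> j (ax 0 s)) (r - t)"
        using m' unfolding ax_zero by (intro insert_prod_cong) simp_all
    qed
    then show ?thesis using serre_symmetrized[of s 0 j r \<epsilon> m' 0] R10 by simp
  next
    case (R11 s \<epsilon>)
    have v: "(qq 0 powi (- 2 * sg \<epsilon> * sg \<epsilon>)) ^ t = qq 0 powi (- 2 * int t)" for t
      by (cases \<epsilon>) (simp_all add: powi_power)
    show ?thesis
      unfolding R11(1) using cubic_serre[of s 0 0 "sg \<epsilon>" \<epsilon> \<epsilon>] R11(2) unfolding v by simp
  next
    case (R12 s \<epsilon>)
    \<comment> \<open>In \<open>R11\<close> the total degree is \<open>sg \<epsilon>\<close>, here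
      it is \<open>- sg \<epsilon>\<close>; so \<open>\<tau>\<close> is opposite to
      \<open>\<epsilon>\<close>, which inverts the twist.\<close>
    have "- 2 * sg \<epsilon> * sg (opp \<epsilon>) = 2" by (cases \<epsilon>) simp_all
    then have v: "(qq 0 powi (- 2 * sg \<epsilon> * sg (opp \<epsilon>))) ^ t = qq 0 powi (2 * int t)" for t
      by (simp only: powi_power)
    show ?thesis
      unfolding R12(1) using cubic_serre[of s 0 "- sg \<epsilon>" 0 "opp \<epsilon>" \<epsilon>] R12(2) unfolding v by simp
  next
    case (R13 s s' \<epsilon>)
    \<comment> \<open>All degrees in \<open>T10\<close> are \<open>sg \<epsilon>\<close> up to sign,
      so their product is non-zero; its order of factors already is that of
      \<open>R13\<close>.\<close>
    have "(\<Sum>k\<le>3. ((-1) ^ k * qbinom (qq 0) 3 k) *\<^sub>K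
       insert_prod 3 (\<lambda>p. x\<^sub>g \<epsilon> 0 (ax (- sg \<epsilon>) s)) (x\<^sub>g (opp \<epsilon>) 0 (ax (sg \<epsilon>) s')) (3 - k)) \<in> L_tor"
      using tor[OF tor_rels.T10[of s s' 0 "\<lambda>_. - sg \<epsilon>" "sg \<epsilon>" \<epsilon>]] R13 by simp
    also have "(\<Sum>k\<le>3. ((-1) ^ k * qbinom (qq 0) 3 k) *\<^sub>K
       insert_prod 3 (\<lambda>p. x\<^sub>g \<epsilon> 0 (ax (- sg \<epsilon>) s)) (x\<^sub>g (opp \<epsilon>) 0 (ax (sg \<epsilon>) s')) (3 - k)) = f"
      unfolding R13(1) by (intro sum.cong refl) (simp add: insert_prod_const)
    finally show ?thesis .
  qed
qed

end

section \<open>Generation by the smaller set\<close>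

text \<open>Without a constant term, the coefficient of degree \<open>m\<close> in a power with
  exponent at least 2 is built from coefficients of degree below \<open>m\<close>. The predicate
  \<open>P\<close> stands for membership in a subring.\<close>

lemma fps_power_nth_below:
  fixes Y :: "'b::ring_1 fps"
  assumes P: "P 0" "P 1" "\<And>f g. P f \<Longrightarrow> P g \<Longrightarrow> P (f + g)" "\<And>f g. P f \<Longrightarrow> P g \<Longrightarrow> P (f * g)"
    and Y0: "fps_nth Y 0 = 0" and Y: "\<And>j. j < m \<Longrightarrow> P (fps_nth Y j)"
  shows "j < m \<Longrightarrow> P (fps_nth (Y ^ k) j)" and "2 \<le> k \<Longrightarrow> P (fps_nth (Y ^ k) m)"
proof -
  have sum: "P (sum f A)" if "\<And>i. i \<in> A \<Longrightarrow> P (f i)" for f :: "nat \<Rightarrow> 'b" and A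
    using that by (induction A rule: infinite_finite_induct) (simp_all add: P)
  have below: "j < m \<Longrightarrow> P (fps_nth (Y ^ k) j)" for j k
    by (induction k arbitrary: j) (auto simp: fps_mult_nth P Y intro!: sum)
  then show "j < m \<Longrightarrow> P (fps_nth (Y ^ k) j)" .
  assume "2 \<le> k"
  then obtain k' where k: "k = Suc (Suc k')" using Suc_le_D numeral_2_eq_2 by (metis Suc_le_mono)
  \<comment> \<open>At \<open>i = 0\<close> the left factor vanishes and at \<open>i = m\<close> the
    right one, which is why the exponent on the right must still be positive.\<close>
  have "P (fps_nth Y i * fps_nth (Y ^ Suc k') (m - i))" if "i \<in> {0..m}" for i
  proof (cases "i = 0 \<or> i = m")
    case True
    then show ?thesis using Y0 P(1) by (auto simp: fps_mult_nth)
  next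
    case False
    then have "i < m" "m - i < m" using that by auto
    then show ?thesis using Y below P(4) by blast
  qed
  then show "P (fps_nth (Y ^ k) m)"
    unfolding k power_Suc[of Y "Suc k'"] fps_mult_nth by (rule sum)
qed

section \<open>The elements expressible by the generators of the small algebra\<close>

context toroidal_affine
begin

text \<open>The elements of the large free algebra whose classes lie in the subalgebra generated by
  \<open>gens0\<close>; surjectivity means that this is everything.\<close>

definition reached :: "tor_free set" where
  "reached = {f. \<exists>g\<in>FA gens0. f \<sim> g}"

lemma FA_gens0_tor: "f \<in> FA gens0 \<Longrightarrow> f \<in> FA tor_gens"
  using FA_mono[OF gens0_subset] by blast

lemma reached_gens0: "f \<in> FA gens0 \<Longrightarrow> f \<in> reached"
  unfolding reached_def using FA_gens0_tor by (auto intro!: bexI[of _ f])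

lemma reached_cong: "f \<sim> g \<Longrightarrow> g \<in> reached \<Longrightarrow> f \<in> reached"
  unfolding reached_def using T.cong_trans by blast

lemma reached_add: "f \<in> reached \<Longrightarrow> g \<in> reached \<Longrightarrow> f + g \<in> reached"
  unfolding reached_def using T.cong_add FA_add by blast

lemma reached_mult: "f \<in> reached \<Longrightarrow> g \<in> reached \<Longrightarrow> f * g \<in> reached"
  unfolding reached_def using T.cong_mult FA_mult by blast

lemma reached_scal: "f \<in> reached \<Longrightarrow> c *\<^sub>K f \<in> reached"
  unfolding reached_def using T.cong_scal FA_scal by blast

lemma reached_diff: "f \<in> reached \<Longrightarrow> g \<in> reached \<Longrightarrow> f - g \<in> reached"
  using reached_add[of f "- g"] reached_scal[of g "- 1"] by simp

lemma reached_sum: "(\<And>i. i \<in> A \<Longrightarrow> f i \<in> reached) \<Longrightarrow> sum f A \<in> reached"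
  by (induction A rule: infinite_finite_induct) (simp_all add: reached_add reached_gens0)

lemma reached_scal_cancel: "c \<noteq> 0 \<Longrightarrow> c *\<^sub>K f \<in> reached \<Longrightarrow> f \<in> reached"
  using reached_scal[of "c *\<^sub>K f" "inverse c"] by simp

text \<open>This strips factors \<open>\<gamma>\<close> and \<open>K\<close>: they have inverses
  that are themselves reached.\<close>

lemma reached_unit_cancel:
  assumes "u' * u \<sim> 1" "u' \<in> reached" "u \<in> FA tor_gens" "f \<in> FA tor_gens" "u * f \<in> reached"
  shows "f \<in> reached"
proof (rule reached_cong)
  show "u' * (u * f) \<in> reached" using assms reached_mult by simp
  show "f \<sim> u' * (u * f)"
    using T.cong_sym[OF T.cong_mult[OF assms(1) T.cong_refl[OF assms(4)]]] by (simp add: mult.assoc)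
qed

lemma gam_half_reached: "s \<in> J \<Longrightarrow> gam_half s m \<in> reached"
  by (intro reached_gens0) simp

lemma gam_half_cancel:
  "s \<in> J \<Longrightarrow> f \<in> FA tor_gens \<Longrightarrow> gam_half s m * f \<in> reached \<Longrightarrow> f \<in> reached"
  by (rule reached_unit_cancel[OF gam_half_inv gam_half_reached]) simp_all

lemma K_cancel: "i \<in> I \<Longrightarrow> f \<in> FA tor_gens \<Longrightarrow> K\<^sub>g \<epsilon> i * f \<in> reached \<Longrightarrow> f \<in> reached"
  using K_inv[of i "opp \<epsilon>"]
  by (intro reached_unit_cancel[of "K\<^sub>g (opp \<epsilon>) i" "K\<^sub>g \<epsilon> i" f]) (simp_all add: reached_gens0)

text \<open>The commutator of two reached elements is reached, and in
  \<open>commutator_plus_minus\<close> the coefficient differs from it by invertible factors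
  only.\<close>

lemma exp_coeff_reached:
  assumes "s \<in> J" "i \<in> I" "0 < m" "t + t' = sg \<tau> * int m"
    and "x\<^sub>g Positive i (ax t s) \<in> reached" "x\<^sub>g Negative i (ax t' s) \<in> reached"
  shows "exp_coeff \<tau> s i m \<in> reached"
proof -
  have "(of_int (sg \<tau>) / (qq i - inverse (qq i))) *\<^sub>K
      (gam_half s (sg \<tau> * (t - t')) * (K\<^sub>g \<tau> i * exp_coeff \<tau> s i m)) \<in> reached"
    using reached_cong[OF T.cong_sym[OF commutator_plus_minus[OF assms(1-4)]]] assms(5,6)
    by (simp add: reached_diff reached_mult)
  moreover have "of_int (sg \<tau>) / (qq i - inverse (qq i)) \<noteq> 0"
    using qq_difference[OF assms(2)] by (cases \<tau>) simp_all
  ultimately have "gam_half s (sg \<tau> * (t - t')) * (K\<^sub>g \<tau> i * exp_coeff \<tau> s i m) \<in> reached"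
    by (rule reached_scal_cancel[rotated])
  then have "K\<^sub>g \<tau> i * exp_coeff \<tau> s i m \<in> reached"
    using assms(1,2) by (intro gam_half_cancel[of s "K\<^sub>g \<tau> i * exp_coeff \<tau> s i m"]) simp_all
  then show ?thesis using assms(1,2) by (intro K_cancel[of i "exp_coeff \<tau> s i m"]) simp_all
qed

lemma a_coefficient_nonzero:
  assumes "i \<in> I" shows "of_int (sg \<tau>) * (qq i - inverse (qq i)) \<noteq> 0"
proof -
  have "of_int (sg \<tau>) \<noteq> (0 :: Cq)" by (cases \<tau>) simp_all
  then show ?thesis using qq_difference[OF assms] by (simp only: mult_eq_0_iff) blast
qed

text \<open>The exponential coefficient of degree \<open>m\<close> is a non-zero multiple of
  \<open>a\<close> in degree \<open>m\<close> plus a polynomial in those of lower degree, so strong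
  induction solves for it.\<close>

lemma a_reached:
  assumes "s \<in> J" "i \<in> I" and x: "\<And>\<epsilon> t. x\<^sub>g \<epsilon> i (ax t s) \<in> reached"
  shows "0 < m \<Longrightarrow> a\<^sub>g s i (sg \<tau> * int m) \<in> reached"
proof (induction m rule: less_induct)
  case (less m)
  define Y where "Y = Abs_fps (\<lambda>l. if l = 0 then 0
     else (of_int (sg \<tau>) * (qq i - inverse (qq i))) *\<^sub>K a\<^sub>g s i (sg \<tau> * int l))"
  have Y: "fps_nth Y j \<in> reached" if "j < m" for j
    using less.IH[OF that] by (simp add: Y_def reached_scal reached_gens0)
  have "fps_nth (Y ^ k) m \<in> reached" if "2 \<le> k" for k
    by (rule fps_power_nth_below(2)[where P = "\<lambda>f. f \<in> reached"])
      (use that Y in \<open>simp_all add: reached_gens0 reached_add reached_mult\<close>, simp add: Y_def)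
  then have rest: "(\<Sum>k\<in>{2..m}. (1 / of_nat (fact k)) *\<^sub>K fps_nth (Y ^ k) m) \<in> reached"
    by (intro reached_sum reached_scal) simp
  have exp: "exp_coeff \<tau> s i m \<in> reached"
    using exp_coeff_reached[OF assms(1,2) less.prems, of "sg \<tau> * int m" 0 \<tau>]
      x[of Positive "sg \<tau> * int m"] x[of Negative 0] by simp
  have eq: "exp_coeff \<tau> s i m
      = fps_nth Y m + (\<Sum>k\<in>{2..m}. (1 / of_nat (fact k)) *\<^sub>K fps_nth (Y ^ k) m)"
    unfolding exp_coeff_def Y_def[symmetric] using less.prems by (intro exp_series_nth) (simp_all add: Y_def)
  have "fps_nth Y m \<in> reached" using reached_diff[OF exp rest] unfolding eq by simp
  then show ?case
    using reached_scal_cancel[OF a_coefficient_nonzero[OF assms(2)]] less.prems by (simp add: Y_def)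
qed

lemma a_nonzero_reached:
  assumes "s \<in> J" "i \<in> I" "\<And>\<epsilon> t. x\<^sub>g \<epsilon> i (ax t s) \<in> reached" "l \<noteq> 0"
  shows "a\<^sub>g s i l \<in> reached"
proof (cases "0 < l")
  case True
  then show ?thesis using a_reached[OF assms(1-3), of "nat l" Positive] by simp
next
  case False
  then show ?thesis using a_reached[OF assms(1-3), of "nat (- l)" Negative] assms(4) by simp
qed

text \<open>\<open>T5\<close> shifts \<open>x\<close> from any lattice point, on an axis or not.
  Moving in unit steps asks only for \<open>a\<close> in degrees 1 and -1, which is all that is
  available at the affine node at the outset.\<close>

lemma x_shift_reached:
  assumes "s \<in> J" "i \<in> I" "j \<in> I" "a i j \<noteq> 0" "k \<in> Lat" and x: "x\<^sub>g \<epsilon> j k \<in> reached"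
    and a: "a\<^sub>g s i 1 \<in> reached" "a\<^sub>g s i (- 1) \<in> reached"
  shows "x\<^sub>g \<epsilon> j (\<lambda>r. k r + ax t s r) \<in> reached"
proof -
  have step: "x\<^sub>g \<epsilon> j (\<lambda>r. k r + ax l s r) \<in> reached"
    if "l = 1 \<or> l = - 1" "k \<in> Lat" "x\<^sub>g \<epsilon> j k \<in> reached" for k l
  proof -
    have "l \<noteq> 0" "a\<^sub>g s i l \<in> reached" using that(1) a by auto
    then have "(of_int (sg \<epsilon>) * acoef i j l) *\<^sub>K
        (gam_half s (- sg \<epsilon> * \<bar>l\<bar>) * x\<^sub>g \<epsilon> j (\<lambda>r. k r + ax l s r)) \<in> reached"
      using reached_cong[OF T.cong_sym[OF a_x_commutator[OF assms(1-3) _ that(2)]]] that(3)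
      by (simp add: reached_diff reached_mult)
    moreover have "of_int (sg \<epsilon>) * acoef i j l \<noteq> 0"
      using acoef_nonzero[OF assms(2,4) \<open>l \<noteq> 0\<close>] by (cases \<epsilon>) simp_all
    ultimately have "gam_half s (- sg \<epsilon> * \<bar>l\<bar>) * x\<^sub>g \<epsilon> j (\<lambda>r. k r + ax l s r) \<in> reached"
      by (rule reached_scal_cancel[rotated])
    then show ?thesis
      by (rule gam_half_cancel[OF assms(1), rotated]) (use assms that in \<open>simp add: Lat_add\<close>)
  qed
  have shift: "(\<lambda>r. (\<lambda>r. k r + ax t s r) r + ax l s r) = (\<lambda>r. k r + ax (t + l) s r)" for t l
    by (simp add: ax_def fun_eq_iff)
  have Lat: "(\<lambda>r. k r + ax t s r) \<in> Lat" for t using assms by (simp add: Lat_add)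
  show ?thesis
  proof (induction t rule: int_induct[where k = 0])
    case base
    have "(\<lambda>r. k r + ax 0 s r) = k" by (simp add: zero_vec_def fun_eq_iff)
    then show ?case using x by simp
  next
    case (step1 t)
    then show ?case using step[OF _ Lat step1(2), of 1] unfolding shift by simp
  next
    case (step2 t)
    then show ?case using step[OF _ Lat step2(2), of "- 1"] unfolding shift by simp
  qed
qed

lemma x_axis_reached:
  assumes "s \<in> J" "i \<in> I" "j \<in> I" "a i j \<noteq> 0" "a\<^sub>g s i 1 \<in> reached" "a\<^sub>g s i (- 1) \<in> reached"
  shows "x\<^sub>g \<epsilon> j (ax t s) \<in> reached"
proof -
  have "(\<lambda>r. zero_vec r + ax t s r) = ax t s" by (simp add: zero_vec_def)
  then show ?thesis
    using x_shift_reached[OF assms(1-4) Lat_zero _ assms(5,6), of \<epsilon> t] assms(3)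
    by (simp add: reached_gens0)
qed

text \<open>The generator \<open>x\<close> of sign minus and degree 1, paired with sign plus in
  degree 0, gives degree 1; the one of sign plus and degree -1, paired with sign minus in degree 0,
  gives degree -1.\<close>

lemma a_zero_node_reached: "s \<in> J \<Longrightarrow> a\<^sub>g s 0 (sg \<tau>) \<in> reached"
proof -
  assume s: "s \<in> J"
  have "exp_coeff \<tau> s 0 1 \<in> reached"
  proof (cases \<tau>)
    case Positive
    then show ?thesis
      using exp_coeff_reached[of s 0 1 0 1 \<tau>] s by (simp add: reached_gens0 gens0_GX0)
  next
    case Negative
    then show ?thesis
      using exp_coeff_reached[of s 0 1 "- 1" 0 \<tau>] s by (simp add: reached_gens0 gens0_GX0)
  qed
  then show ?thesis
    unfolding exp_coeff_one by (rule reached_scal_cancel[OF a_coefficient_nonzero, rotated]) simp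
qed

text \<open>At the affine node \<open>a\<close> shifts \<open>x\<close> of the same node, as the
  diagonal entry is 2. A completed node supplies its \<open>a\<close>, which shift every adjacent
  \<open>x\<close> out of degree zero, and connectedness exhausts all nodes.\<close>

lemma x_all_axes_reached:
  assumes "j \<in> I" "s \<in> J"
  shows "x\<^sub>g \<epsilon> j (ax t s) \<in> reached"
proof -
  define S where "S = {j. \<forall>s\<in>J. \<forall>\<epsilon> t. x\<^sub>g \<epsilon> j (ax t s) \<in> reached}"
  have "I \<subseteq> S"
  proof (rule connected)
    show "0 \<in> S"
      using x_axis_reached[of _ 0 0] a_zero_node_reached[of _ Positive] a_zero_node_reached[of _ Negative]
        diagonal[of 0] by (simp add: S_def)
    fix i j assume "i \<in> S \<inter> I" "j \<in> I" "a i j \<noteq> 0"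
    then show "j \<in> S"
      using x_axis_reached[of _ i j] a_nonzero_reached[of _ i] by (simp add: S_def)
  qed
  then show ?thesis using assms by (auto simp: S_def)
qed

lemma a_all_reached: "s \<in> J \<Longrightarrow> i \<in> I \<Longrightarrow> l \<noteq> 0 \<Longrightarrow> a\<^sub>g s i l \<in> reached"
  using a_nonzero_reached x_all_axes_reached by blast

text \<open>The vector \<open>k\<close> is built up one coordinate at a time; each is added by
  \<open>a\<close> of the same node along that axis.\<close>

lemma x_all_reached:
  assumes "i \<in> I" "k \<in> Lat" shows "x\<^sub>g \<epsilon> i k \<in> reached"
proof -
  have "x\<^sub>g \<epsilon> i (\<lambda>r. if r \<in> F then k r else 0) \<in> reached" if "finite F" "F \<subseteq> J" for F
    using that
  proof (induction F)
    case empty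
    have "x\<^sub>g \<epsilon> i zero_vec \<in> reached" using assms by (simp add: reached_gens0)
    then show ?case by (simp add: zero_vec_def)
  next
    case (insert s F)
    have "(\<lambda>r. if r \<in> insert s F then k r else 0)
        = (\<lambda>r. (if r \<in> F then k r else 0) + ax (k s) s r)"
      using insert.hyps by (auto simp: ax_def fun_eq_iff)
    moreover have "(\<lambda>r. if r \<in> F then k r else 0) \<in> Lat"
      using insert.prems by (auto simp: Lat_def)
    ultimately show ?case
      using x_shift_reached[of s i i "\<lambda>r. if r \<in> F then k r else 0" \<epsilon> "k s"]
        insert assms diagonal a_all_reached by simp
  qed
  moreover have "(\<lambda>r. if r \<in> J then k r else 0) = k"
    using assms by (auto simp: Lat_def fun_eq_iff)
  ultimately show ?thesis by (metis J_def finite_atLeastAtMost order_refl)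
qed

lemma FA_reached: 
  assumes "f \<in> FA tor_gens" shows "f \<in> reached"
  using assms
proof (induction f rule: FA_induct)
  case (gen g)
  then show ?case
    unfolding tor_gens_def using x_all_reached a_all_reached by (auto intro: reached_gens0)
qed (auto intro: reached_gens0 reached_scal reached_add reached_mult)

lemma canonical_epi_exists: "\<exists>\<pi>. canonical_epi \<pi>"
proof -
  have "\<exists>\<pi>\<in>alg_epi (presented gens0 rels0) (presented tor_gens tor_rels).
      \<forall>f\<in>FA gens0. \<pi> (pres_class gens0 rels0 f) = pres_class tor_gens tor_rels f"
  proof (rule presentation_epi)
    show "presentation gens0 rels0" by unfold_locales (rule rels0_closed)
    show "\<And>f. f \<in> FA tor_gens \<Longrightarrow> \<exists>g\<in>FA gens0. f \<sim> g"
      using FA_reached by (simp add: reached_def)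
  qed (fact T.presentation_axioms gens0_subset rels0_subset)+
  then show ?thesis unfolding canonical_epi_def U_0_def U_tor_def by auto
qed

lemma canonical_epi_isomorphism:
  assumes "canonical_epi \<pi>"
  shows "alg_isomorphic U_tor (alg_quot U_0 (a_kernel U_0 U_tor \<pi>))"
proof -
  interpret P0: presentation gens0 rels0 by unfold_locales (rule rels0_closed)
  show ?thesis
    using assms unfolding canonical_epi_def U_0_def U_tor_def
    by (intro alg_first_isomorphism T.presented_ring P0.presented_ring P0.presented_smult_closed) simp_all
qed

end

theorem theorem3p13:
  fixes scale :: "complex \<Rightarrow> 'g::ab_group_add \<Rightarrow> 'g"
    and lie :: "'g \<Rightarrow> 'g \<Rightarrow> 'g"
    and n N :: nat
    and a :: "nat \<Rightarrow> nat \<Rightarrow> int"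
    and d :: "nat \<Rightarrow> nat"
  assumes "simple_lie_algebra scale lie"
    and "complex_lie_algebra.affine_cartan_matrix scale lie n a"
    and "\<forall>i\<in>{0..n}. 0 < d i"
    and "\<forall>i\<in>{0..n}. \<forall>j\<in>{0..n}. int (d i) * a i j = int (d j) * a j i"
    and "N > 2"
  shows "(\<exists>\<pi>. toroidal_data.canonical_epi n N a d \<pi>) \<and>
    (\<forall>\<pi>. toroidal_data.canonical_epi n N a d \<pi> \<longrightarrow>
       alg_isomorphic (toroidal_data.U_tor n N a d)
         (alg_quot (toroidal_data.U_0 n N a d)
            (a_kernel (toroidal_data.U_0 n N a d) (toroidal_data.U_tor n N a d) \<pi>)))"
proof -
  interpret simple_lie_algebra scale lie by fact
  have I: "toroidal_data.I n = {0..n}" by (simp add: toroidal_data.I_def)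
  \<comment> \<open>Connectedness is stated for a symmetric pattern of zeros; symmetrizability by
    positive integers provides it.\<close>
  have sym: "a j i = 0" if "i \<in> {0..n}" "j \<in> {0..n}" "a i j = 0" for i j
  proof -
    have "int (d j) * a j i = 0" using assms(4) that by (metis mult_zero_right)
    moreover have "0 < d j" using assms(3) that by blast
    ultimately show ?thesis by simp
  qed
  interpret toroidal_affine n N a d
  proof
    fix S assume S: "0 \<in> S" "\<And>i j. i \<in> S \<inter> toroidal_data.I n \<Longrightarrow> j \<in> toroidal_data.I n \<Longrightarrow> a i j \<noteq> 0 \<Longrightarrow> j \<in> S"
    show "toroidal_data.I n \<subseteq> S"
      using affine_cartan_matrix_connected[OF assms(2) _ S(1)] sym S(2) unfolding I by blast
  qed (use assms(3,5) affine_cartan_matrix_diagonal[OF assms(2)] in \<open>simp_all add: I\<close>)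
  show ?thesis using canonical_epi_exists canonical_epi_isomorphism by blast
qed

end
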